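(* Let $\Xi\subseteq\mathbb{R}^m$ be convex, $\widehat\xi_1,\dots,\widehat\xi_N\in\Xi$, $\widehat{\mathbb P}_N=\frac1N\sum_{i=1}^N\delta_{\widehat\xi_i}$, $\varepsilon\ge0$, $\alpha\in(1/2,1)$, and let $\|\cdot\|$ be a norm on $\mathbb{R}^m$ with dual norm $\|\cdot\|_*$. Suppose $\ell(x)=\max_{j=1,\dots,K}\{a_j^\top x+b_j\}$ with $a_j\in\mathbb{R}^m$, $b_j\in\mathbb{R}$. Then the worst-case expectation problem $$\sup_{\mathbb P\in\mathbb{B}^{\alpha}_{(2),\varepsilon}(\widehat{\mathbb P}_N)}\mathbb{E}^{\mathbb P}[\ell(\xi)]$$ is equivalent to the convex maximization problem $$\begin{aligned}\sup_{p_{ij}\ge0,\ y_{ij}\in\mathbb{R}^m}\ \ &\frac1N\sum_{i=1}^N\sum_{j=1}^K\Big(a_j^\top y_{ij}+(a_j^\top\widehat\xi_i+b_j)p_{ij}\Big)\\ \text{subject to}\ \ &\frac1N\sum_{i=1}^N\sum_{j=1}^K(\|y_{ij}\|-\varepsilon p_{ij})_++\frac{1-\alpha}{2\alpha-1}\,\frac1N\sum_{i=1}^N\sum_{j=1}^K\|y_{ij}\|\le\frac{1-\alpha}{2\alpha-1}\,\varepsilon,\\ &\sum_{j=1}^K p_{ij}=1,\ i=1,\dots,N,\qquad \widehat\xi_i+\frac{y_{ij}}{p_{ij}}\in\Xi,\ \forall i,j,\end{aligned}$$ where $y_{ij}/p_{ij}$ reads as $\infty$ if $y_{ij}\ne\mathbf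 0$, $p_{ij}=0$, and as $\mathbf 0$ if $y_{ij}=\mathbf 0$, $p_{ij}=0$. Moreover, the problem is also equivalent to the convex minimization problem $$\begin{aligned}\inf_{\lambda,s,u_{ij},v_{ij}}\ \ &\lambda\varepsilon+\frac1N\sum_{i=1}^N s_i\\ \text{subject to}\ \ &b_j+\sigma_\Xi(u_{ij}+a_j)-u_{ij}^\top\widehat\xi_i+\|v_{ij}\|_*\,\varepsilon\le s_i,\quad\forall i,j,\\ &\|v_{ij}\|_*\le\lambda,\quad\forall i,j,\\ &\|u_{ij}+v_{ij}\|_*\le\frac{1-\alpha}{2\alpha-1}\,\lambda,\quad\forall i,j,\end{aligned}$$ where $\lambda\in\mathbb{R}$, $s\in\mathbb{R}^N$, $u_{ij},v_{ij}\in\mathbb{R}^m$, and $\sigma_\Xi$ is the support function of $\Xi$.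
   Context: For an integrable random variable $X$ and $\alpha\in[1/2,1)$, the expectile $e_\alpha(X)$ is the unique solution $x$ of $\alpha\,\mathbb{E}[(X-x)_+]=(1-\alpha)\,\mathbb{E}[(X-x)_-]$, with $a_+=\max\{a,0\}$, $a_-=\max\{-a,0\}$. The expectile-Wasserstein metric is $d_{e_\alpha}(\mathbb P_1,\mathbb P_2)=\inf_\Pi e_\alpha^{\Pi}(\|\xi_1-\xi_2\|)$, infimum over joint distributions $\Pi$ of $(\xi_1,\xi_2)$ with marginals $\mathbb P_1,\mathbb P_2$, and $\mathbb{B}^{\alpha}_{(2),\varepsilon}(\widehat{\mathbb P}_N)=\{\mathbb P\in\mathcal M(\Xi): d_{e_\alpha}(\widehat{\mathbb P}_N,\mathbb P)\le\varepsilon\}$, where $\mathcal M(\Xi)$ is the set of probability distributions supported on $\Xi$. $\sigma_\Xi(u)=\sup_{\xi\in\Xi}u^\top\xi$.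
   Formalization: The minimization objective has first term (1-α)/(2α-1)·λε instead of λε; with λε the equality fails, e.g. m=N=K=1, Ξ=ℝ, sample 0, ℓ(x)=x, ε=1, α=3/5 (maximum 1, but minimum at most 1/2). *)

theory Defs
  imports "HOL-Probability.Probability"
begin

section \<open>Norms on a finite-dimensional space, dual norm, support function\<close>

text \<open>An arbitrary norm, as opposed to the Euclidean \<^const>\<open>norm\<close> of the type \<open>real^'m\<close>.\<close>

definition is_norm :: "('a::real_vector \<Rightarrow> real) \<Rightarrow> bool" where
  "is_norm nrm \<longleftrightarrow>
     (\<forall>x. 0 \<le> nrm x) \<and>
     (\<forall>x. nrm x = 0 \<longleftrightarrow> x = 0) \<and>
     (\<forall>c x. nrm (c *\<^sub>R x) = \<bar>c\<bar> * nrm x) \<and>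
     (\<forall>x y. nrm (x + y) \<le> nrm x + nrm y)"

definition dual_norm :: "('a::euclidean_space \<Rightarrow> real) \<Rightarrow> 'a \<Rightarrow> real" where
  "dual_norm nrm u = (SUP x\<in>{x. nrm x \<le> 1}. u \<bullet> x)"

definition support_fun :: "'a::euclidean_space set \<Rightarrow> 'a \<Rightarrow> ereal" where
  "support_fun \<Xi> u = (SUP \<xi>\<in>\<Xi>. ereal (u \<bullet> \<xi>))"


section \<open>Expectiles and the expectile-Wasserstein ball\<close>

definition expectile :: "real \<Rightarrow> 'w measure \<Rightarrow> ('w \<Rightarrow> real) \<Rightarrow> real" where
  "expectile \<alpha> M X =
     (THE x. \<alpha> * (\<integral>\<omega>. max (X \<omega> - x) 0 \<partial>M) = (1 - \<alpha>) * (\<integral>\<omega>. max (- (X \<omega> - x)) 0 \<partial>M))"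

definition couplings :: "'a::euclidean_space measure \<Rightarrow> 'a measure \<Rightarrow> ('a \<times> 'a) measure set" where
  "couplings P Q = {\<gamma>. prob_space \<gamma> \<and> sets \<gamma> = sets (borel \<Otimes>\<^sub>M borel) \<and>
                        distr \<gamma> borel fst = P \<and> distr \<gamma> borel snd = Q}"

text \<open>
  Expectiles are defined for integrable random variables only. A coupling whose
  transport distance is not integrable is given the value \<open>\<infinity>\<close>, so a distribution
  without a finite first moment is at distance \<open>\<infinity>\<close> from every empirical distribution.
\<close>

definition expectile_dist ::
  "('a::euclidean_space \<Rightarrow> real) \<Rightarrow> real \<Rightarrow> 'a measure \<Rightarrow> 'a measure \<Rightarrow> ereal" where
  "expectile_dist nrm \<alpha> P Q =
     (INF \<gamma>\<in>couplings P Q.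
        if integrable \<gamma> (\<lambda>(\<xi>\<^sub>1, \<xi>\<^sub>2). nrm (\<xi>\<^sub>1 - \<xi>\<^sub>2))
        then ereal (expectile \<alpha> \<gamma> (\<lambda>(\<xi>\<^sub>1, \<xi>\<^sub>2). nrm (\<xi>\<^sub>1 - \<xi>\<^sub>2)))
        else \<infinity>)"

text \<open>
  A convex set need not be Borel; the almost-everywhere quantifier says that the
  complement of \<open>\<Xi>\<close> is contained in a null set, i.e. \<open>P \<Xi> = 1\<close> when \<open>\<Xi>\<close> is Borel.
\<close>

definition distributions_on :: "'a::euclidean_space set \<Rightarrow> 'a measure set" where
  "distributions_on \<Xi> = {P. prob_space P \<and> sets P = sets borel \<and> (AE \<xi> in P. \<xi> \<in> \<Xi>)}"

definition expectile_ball ::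
  "('a::euclidean_space \<Rightarrow> real) \<Rightarrow> real \<Rightarrow> real \<Rightarrow> 'a set \<Rightarrow> 'a measure \<Rightarrow> 'a measure set" where
  "expectile_ball nrm \<alpha> \<epsilon> \<Xi> P0 =
     {P \<in> distributions_on \<Xi>. expectile_dist nrm \<alpha> P0 P \<le> ereal \<epsilon>}"

definition empirical :: "('n::finite \<Rightarrow> 'a::euclidean_space) \<Rightarrow> 'a measure" where
  "empirical \<xi>h = distr (uniform_count_measure UNIV) borel \<xi>h"

lemma measure_empirical:
  fixes \<xi>h :: "'n::finite \<Rightarrow> 'a::euclidean_space"
  assumes "B \<in> sets borel"
  shows "measure (empirical \<xi>h) B = (1 / real CARD('n)) * (\<Sum>i\<in>UNIV. indicator B (\<xi>h i))"
proof -
  have "measure (empirical \<xi>h) B = measure (uniform_count_measure UNIV) (\<xi>h -` B)"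
    unfolding empirical_def using assms
    by (subst measure_distr) (auto simp: space_uniform_count_measure sets_uniform_count_measure measurable_def)
  also have "\<dots> = real (card (\<xi>h -` B)) / real CARD('n)"
    by (subst measure_uniform_count_measure) auto
  also have "real (card (\<xi>h -` B)) = (\<Sum>i\<in>UNIV. indicator (\<xi>h -` B) i)"
    by (simp add: indicator_def sum.If_cases vimage_def)
  finally show ?thesis
    by (simp add: indicator_def)
qed


section \<open>The two finite-dimensional programs\<close>

text \<open>
  The index sets of the samples (\<open>i = 1..N\<close>) and of the affine pieces (\<open>j = 1..K\<close>) are
  finite types \<open>'n\<close> and \<open>'k\<close>, so that decision variables live in real vector spaces.

  In \<open>max_feasible\<close> the requirement \<open>\<xi>h i + y i j / p i j \<in> \<Xi>\<close> uses the convention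
  \<open>y / 0 = \<infinity>\<close> for \<open>y \<noteq> 0\<close> and \<open>0 / 0 = 0\<close>. The first case never belongs to \<open>\<Xi>\<close>, hence
  the implication; the second agrees with \<open>inverse 0 = 0\<close>.
\<close>

definition max_feasible ::
  "('a::euclidean_space \<Rightarrow> real) \<Rightarrow> real \<Rightarrow> real \<Rightarrow> 'a set \<Rightarrow> ('n::finite \<Rightarrow> 'a) \<Rightarrow>
     ((real^'k^'n) \<times> ('a^'k^'n)) set" where
  "max_feasible nrm \<alpha> \<epsilon> \<Xi> \<xi>h =
     {(p, y).
        (\<forall>i j. 0 \<le> p $ i $ j) \<and>
        (1 / real CARD('n)) * (\<Sum>i\<in>UNIV. \<Sum>j\<in>UNIV. max (nrm (y $ i $ j) - \<epsilon> * p $ i $ j) 0)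
          + (1 - \<alpha>) / (2 * \<alpha> - 1) * ((1 / real CARD('n)) * (\<Sum>i\<in>UNIV. \<Sum>j\<in>UNIV. nrm (y $ i $ j)))
          \<le> (1 - \<alpha>) / (2 * \<alpha> - 1) * \<epsilon> \<and>
        (\<forall>i. (\<Sum>j\<in>UNIV. p $ i $ j) = 1) \<and>
        (\<forall>i j. (p $ i $ j = 0 \<longrightarrow> y $ i $ j = 0) \<and> \<xi>h i + y $ i $ j /\<^sub>R p $ i $ j \<in> \<Xi>)}"

definition max_objective ::
  "('k::finite \<Rightarrow> 'a::euclidean_space) \<Rightarrow> ('k \<Rightarrow> real) \<Rightarrow> ('n::finite \<Rightarrow> 'a) \<Rightarrow>
     (real^'k^'n) \<times> ('a^'k^'n) \<Rightarrow> real" where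
  "max_objective a b \<xi>h = (\<lambda>(p, y).
     (1 / real CARD('n)) *
       (\<Sum>i\<in>UNIV. \<Sum>j\<in>UNIV. a j \<bullet> (y $ i $ j) + (a j \<bullet> \<xi>h i + b j) * p $ i $ j))"

definition min_feasible ::
  "('a::euclidean_space \<Rightarrow> real) \<Rightarrow> real \<Rightarrow> real \<Rightarrow> 'a set \<Rightarrow> ('k::finite \<Rightarrow> 'a) \<Rightarrow> ('k \<Rightarrow> real) \<Rightarrow>
     ('n::finite \<Rightarrow> 'a) \<Rightarrow> (real \<times> (real^'n) \<times> ('a^'k^'n) \<times> ('a^'k^'n)) set" where
  "min_feasible nrm \<alpha> \<epsilon> \<Xi> a b \<xi>h =
     {(l, s, u, v). \<forall>i j.
        ereal (b j) + support_fun \<Xi> (u $ i $ j + a j)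
          + ereal (- (u $ i $ j \<bullet> \<xi>h i) + dual_norm nrm (v $ i $ j) * \<epsilon>) \<le> ereal (s $ i) \<and>
        dual_norm nrm (v $ i $ j) \<le> l \<and>
        dual_norm nrm (u $ i $ j + v $ i $ j) \<le> (1 - \<alpha>) / (2 * \<alpha> - 1) * l}"

text \<open>
  The multiplier \<open>l\<close> belongs to the inequality constraint of \<open>max_feasible\<close>, whose
  right-hand side is \<open>(1 - \<alpha>) / (2 * \<alpha> - 1) * \<epsilon>\<close>: this is where the coefficient of \<open>l\<close> comes from.
  With coefficient \<open>\<epsilon>\<close> instead (and the constraints of \<open>min_feasible\<close> unchanged) the two
  programs have different values in general unless \<open>\<alpha> = 2/3\<close>: for \<open>\<Xi> = \<real>\<close>, one sample \<open>0\<close>, loss \<open>x\<close>,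
  \<open>\<epsilon> = 1\<close>, \<open>\<alpha> = 3/5\<close>, the maximum is \<open>1\<close>, whereas \<open>l = 1/2, s = 0, u = -1, v = 0\<close> is feasible
  and would give value \<open>1/2\<close>.
\<close>

definition min_objective ::
  "real \<Rightarrow> real \<Rightarrow> real \<times> (real^'n::finite) \<times> ('a::euclidean_space^'k::finite^'n) \<times> ('a^'k^'n) \<Rightarrow> real" where
  "min_objective \<alpha> \<epsilon> = (\<lambda>(l, s, u, v).
     (1 - \<alpha>) / (2 * \<alpha> - 1) * l * \<epsilon> + (1 / real CARD('n)) * (\<Sum>i\<in>UNIV. s $ i))"

end

theory Submission
  imports Defs
begin

text \<open>
  Write \<open>c = (1 - \<alpha>) / (2 * \<alpha> - 1)\<close>. The expectile of an integrable \<open>X\<close> is at most \<open>t\<close> exactly when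
  \<open>E[(X - t)\<^sub>+] + c * E[X] \<le> c * t\<close> (\<open>expectile_le_iff\<close>). So a coupling whose transport distance has
  expectile at most \<open>\<epsilon>\<close> is one whose expected cost, for the convex cost function
  \<open>(nrm x - \<epsilon>)\<^sub>+ + c * nrm x\<close> of the displacement \<open>x\<close>, is at most \<open>c * \<epsilon>\<close>. The worst-case problem is thus a
  transport problem with one linear constraint, and the three values are shown to be equal by
  three inequalities in a circle.

  A feasible point of the maximization program is a discrete coupling that splits every sample
  among at most as many targets as the loss has pieces; hence its objective is at most the
  worst-case expectation (\<open>max_feasible_distribution\<close>).

  A feasible point of the minimization program bounds the loss pointwise by a constant for the
  sample plus \<open>l\<close> times the cost of the displacement, and integrating this against a coupling
  bounds the worst-case expectation (\<open>weak_duality\<close>). Couplings with expectile slightly above \<open>\<epsilon>\<close>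
  are admitted, since the infimum over couplings need not be attained.

  Finally, every bound on the maximization program is met by a feasible point of the minimization
  program (\<open>strong_duality\<close>). A separating line in the plane gives the multiplier \<open>l\<close> of the
  inequality constraint (\<open>Lagrange_multiplier\<close>); the penalized problem separates over samples and
  pieces, and for each of these a hyperplane separating a concave from a convex function gives \<open>u\<close>
  and \<open>v\<close> (\<open>Fenchel_multipliers\<close>).
\<close>

section \<open>Norms and dual norms\<close>

lemma is_normD:
  assumes "is_norm nrm"
  shows is_norm_nonneg: "0 \<le> nrm x"
    and is_norm_zero: "nrm 0 = 0"
    and is_norm_eq_0: "nrm x = 0 \<longleftrightarrow> x = 0"
    and is_norm_scale: "nrm (c *\<^sub>R x) = \<bar>c\<bar> * nrm x"
    and is_norm_triangle: "nrm (x + y) \<le> nrm x + nrm y"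
    and is_norm_minus: "nrm (- x) = nrm x"
proof -
  show "nrm (- x) = nrm x"
    using assms unfolding is_norm_def by (metis abs_minus_cancel abs_one mult_1 scaleR_minus1_left)
qed (use assms in \<open>auto simp: is_norm_def\<close>)

lemma convex_on_is_norm:
  assumes "is_norm nrm"
  shows "convex_on UNIV nrm"
proof (rule convex_onI)
  fix t :: real and x y assume t: "0 < t" "t < 1"
  have "nrm ((1 - t) *\<^sub>R x + t *\<^sub>R y) \<le> nrm ((1 - t) *\<^sub>R x) + nrm (t *\<^sub>R y)"
    by (rule is_norm_triangle[OF assms])
  then show "nrm ((1 - t) *\<^sub>R x + t *\<^sub>R y) \<le> (1 - t) * nrm x + t * nrm y"
    using t by (simp add: is_norm_scale[OF assms])
qed simp

lemma continuous_on_is_norm: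
  fixes nrm :: "'a::euclidean_space \<Rightarrow> real"
  assumes "is_norm nrm"
  shows "continuous_on S nrm"
  using convex_on_continuous[OF open_UNIV convex_on_is_norm[OF assms]] continuous_on_subset
  by blast

text \<open>
  On the Euclidean unit sphere, which is compact, the continuous function \<open>nrm\<close> attains a
  positive minimum. This makes the supremum in the dual norm finite.
\<close>

lemma norm_le_is_norm:
  fixes nrm :: "'a::euclidean_space \<Rightarrow> real"
  assumes "is_norm nrm"
  obtains C where "0 < C" "\<And>x. norm x \<le> C * nrm x"
proof -
  have "sphere (0::'a) 1 \<noteq> {}" by simp
  then obtain x0 :: 'a where x0: "norm x0 = 1" and min: "\<And>y. norm y = 1 \<Longrightarrow> nrm x0 \<le> nrm y"
    using continuous_attains_inf[of "sphere (0::'a) 1" nrm] continuous_on_is_norm[OF assms]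
    by (auto simp: dist_norm)
  have pos: "0 < nrm x0"
    using x0 is_norm_nonneg[OF assms, of x0] is_norm_eq_0[OF assms, of x0]
    by (metis less_eq_real_def norm_zero zero_neq_one)
  have "norm x \<le> (1 / nrm x0) * nrm x" for x :: 'a
  proof (cases "x = 0")
    case False
    have "nrm x0 \<le> nrm ((1 / norm x) *\<^sub>R x)"
      using False by (intro min) simp
    then show ?thesis
      using False pos by (simp add: is_norm_scale[OF assms] field_simps)
  qed (simp add: is_norm_zero[OF assms])
  then show ?thesis using that[of "1 / nrm x0"] pos by simp
qed

lemma dual_norm_bdd:
  fixes nrm :: "'a::euclidean_space \<Rightarrow> real"
  assumes "is_norm nrm"
  shows "bdd_above ((\<lambda>x. u \<bullet> x) ` {x. nrm x \<le> 1})"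
proof -
  obtain C where C: "0 < C" "\<And>x. norm x \<le> C * nrm x"
    using norm_le_is_norm[OF assms] by blast
  have "u \<bullet> x \<le> norm u * C" if "nrm x \<le> 1" for x
  proof -
    have "u \<bullet> x \<le> norm u * norm x" by (rule norm_cauchy_schwarz)
    also have "norm x \<le> C"
      using C(2)[of x] mult_left_mono[OF that, of C] C(1) by linarith
    finally show ?thesis by (simp add: mult_left_mono)
  qed
  then show ?thesis by (intro bdd_aboveI[of _ "norm u * C"]) auto
qed

lemma dual_norm_Hoelder:
  fixes nrm :: "'a::euclidean_space \<Rightarrow> real"
  assumes "is_norm nrm"
  shows "u \<bullet> x \<le> dual_norm nrm u * nrm x"
proof (cases "x = 0")
  case False
  then have pos: "0 < nrm x"
    using is_norm_nonneg[OF assms, of x] is_norm_eq_0[OF assms, of x] by simp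
  have "u \<bullet> ((1 / nrm x) *\<^sub>R x) \<le> dual_norm nrm u"
    unfolding dual_norm_def
    by (rule cSUP_upper[OF _ dual_norm_bdd[OF assms]]) (use pos in \<open>simp add: is_norm_scale[OF assms]\<close>)
  then show ?thesis using pos by (simp add: field_simps)
qed (simp add: is_norm_zero[OF assms])

lemma dual_norm_nonneg:
  fixes nrm :: "'a::euclidean_space \<Rightarrow> real"
  assumes "is_norm nrm"
  shows "0 \<le> dual_norm nrm u"
proof -
  have "u \<bullet> 0 \<le> dual_norm nrm u"
    unfolding dual_norm_def
    by (rule cSUP_upper[OF _ dual_norm_bdd[OF assms]]) (simp add: is_norm_zero[OF assms])
  then show ?thesis by simp
qed

text \<open>
  Together with \<open>dual_norm_Hoelder\<close> this makes \<open>dual_norm nrm u\<close> the least constant \<open>K \<ge> 0\<close> by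
  which \<open>nrm\<close> dominates \<open>u\<close>; sublinearity of the dual norm follows from the two.
\<close>

lemma dual_norm_leI:
  fixes nrm :: "'a::euclidean_space \<Rightarrow> real"
  assumes "is_norm nrm" "0 \<le> K" "\<And>x. u \<bullet> x \<le> K * nrm x"
  shows "dual_norm nrm u \<le> K"
  unfolding dual_norm_def
proof (rule cSUP_least)
  show "{x. nrm x \<le> 1} \<noteq> {}" using is_norm_zero[OF assms(1)] by (auto intro!: exI[of _ 0])
  fix x assume "x \<in> {x. nrm x \<le> 1}"
  then show "u \<bullet> x \<le> K"
    using assms(3)[of x] mult_left_mono[of "nrm x" 1 K] assms(2) by simp
qed

lemma dual_norm_scale_le:
  fixes nrm :: "'a::euclidean_space \<Rightarrow> real"
  assumes "is_norm nrm" "0 \<le> c"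
  shows "dual_norm nrm (c *\<^sub>R u) \<le> c * dual_norm nrm u"
proof (rule dual_norm_leI[OF assms(1)])
  fix x
  show "c *\<^sub>R u \<bullet> x \<le> c * dual_norm nrm u * nrm x"
    using mult_left_mono[OF dual_norm_Hoelder[OF assms(1)] assms(2), of u x] by (simp add: mult.assoc)
qed (simp add: assms dual_norm_nonneg)

lemma dual_norm_triangle:
  fixes nrm :: "'a::euclidean_space \<Rightarrow> real"
  assumes "is_norm nrm"
  shows "dual_norm nrm (u + v) \<le> dual_norm nrm u + dual_norm nrm v"
proof (rule dual_norm_leI[OF assms])
  fix x
  show "(u + v) \<bullet> x \<le> (dual_norm nrm u + dual_norm nrm v) * nrm x"
    using dual_norm_Hoelder[OF assms, of u x] dual_norm_Hoelder[OF assms, of v x]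
    by (simp add: inner_add_left distrib_right)
qed (simp add: assms dual_norm_nonneg)

lemma dual_norm_zero:
  fixes nrm :: "'a::euclidean_space \<Rightarrow> real"
  assumes "is_norm nrm"
  shows "dual_norm nrm 0 = 0"
  using dual_norm_scale_le[OF assms, of 0 0] dual_norm_nonneg[OF assms, of 0] by simp

lemma dual_norm_minus:
  fixes nrm :: "'a::euclidean_space \<Rightarrow> real"
  assumes "is_norm nrm"
  shows "dual_norm nrm (- u) = dual_norm nrm u"
proof -
  have le: "dual_norm nrm (- u) \<le> dual_norm nrm u" for u
  proof (rule dual_norm_leI[OF assms dual_norm_nonneg[OF assms]])
    fix x show "- u \<bullet> x \<le> dual_norm nrm u * nrm x"
      using dual_norm_Hoelder[OF assms, of u "- x"] by (simp add: is_norm_minus[OF assms])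
  qed
  show ?thesis using le[of u] le[of "- u"] by simp
qed

lemma dual_norm_convex_le:
  fixes nrm :: "'a::euclidean_space \<Rightarrow> real"
  assumes nrm: "is_norm nrm" and t: "0 \<le> s" "0 \<le> t"
    and le: "dual_norm nrm u \<le> k" "dual_norm nrm v \<le> l"
  shows "dual_norm nrm (s *\<^sub>R u + t *\<^sub>R v) \<le> s * k + t * l"
proof -
  have "dual_norm nrm (s *\<^sub>R u + t *\<^sub>R v) \<le> s * dual_norm nrm u + t * dual_norm nrm v"
    using dual_norm_triangle[OF nrm, of "s *\<^sub>R u" "t *\<^sub>R v"]
      dual_norm_scale_le[OF nrm t(1), of u] dual_norm_scale_le[OF nrm t(2), of v] by linarith
  also have "\<dots> \<le> s * k + t * l"
    using le t by (intro add_mono mult_left_mono)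
  finally show ?thesis .
qed

section \<open>Expectiles\<close>

text \<open>
  Since \<open>z\<^sub>- = z\<^sub>+ - z\<close>, the negative part can be eliminated from the defining equation.
  This produces the constant \<open>(1 - \<alpha>) / (2 * \<alpha> - 1)\<close> of both programs.
\<close>

lemma expectile_equation_iff:
  fixes X :: "'w \<Rightarrow> real"
  assumes "prob_space M" and X: "integrable M X" and \<alpha>: "1/2 < \<alpha>"
  shows "\<alpha> * (\<integral>\<omega>. max (X \<omega> - x) 0 \<partial>M) = (1 - \<alpha>) * (\<integral>\<omega>. max (- (X \<omega> - x)) 0 \<partial>M)
     \<longleftrightarrow> (\<integral>\<omega>. max (X \<omega> - x) 0 \<partial>M) + (1 - \<alpha>) / (2 * \<alpha> - 1) * ((\<integral>\<omega>. X \<omega> \<partial>M) - x) = 0"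
proof -
  interpret prob_space M by fact
  let ?I = "\<integral>\<omega>. max (X \<omega> - x) 0 \<partial>M"
  have "(\<integral>\<omega>. max (- (X \<omega> - x)) 0 \<partial>M) = (\<integral>\<omega>. max (X \<omega> - x) 0 - (X \<omega> - x) \<partial>M)"
    by (intro Bochner_Integration.integral_cong) auto
  also have "\<dots> = ?I - ((\<integral>\<omega>. X \<omega> \<partial>M) - x)"
    using X by (simp add: prob_space)
  finally have *: "(\<integral>\<omega>. max (- (X \<omega> - x)) 0 \<partial>M) = ?I - ((\<integral>\<omega>. X \<omega> \<partial>M) - x)" .
  show ?thesis
    unfolding * using \<alpha> by (simp add: field_simps)
qed

text \<open>
  The function \<open>\<phi> t = E[(X - t)\<^sub>+] + c * (E[X] - t)\<close> is strictly decreasing because \<open>c > 0\<close>, it is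
  Lipschitz continuous, and it changes sign. So it has exactly one root, the expectile, and
  \<open>expectile \<le> t\<close> amounts to \<open>\<phi> t \<le> 0\<close>. The latter form replaces the implicitly defined
  expectile by an inequality between integrals, in which integrands can be compared pointwise.
\<close>

lemma
  fixes X :: "'w \<Rightarrow> real" and \<alpha> :: real
  assumes "prob_space M" and X: "integrable M X" and \<alpha>: "1/2 < \<alpha>" "\<alpha> < 1"
  defines "c \<equiv> (1 - \<alpha>) / (2 * \<alpha> - 1)"
  shows expectile_root:
      "(\<integral>\<omega>. max (X \<omega> - expectile \<alpha> M X) 0 \<partial>M) + c * (\<integral>\<omega>. X \<omega> \<partial>M) = c * expectile \<alpha> M X"
    and expectile_le_iff:
      "expectile \<alpha> M X \<le> t \<longleftrightarrow> (\<integral>\<omega>. max (X \<omega> - t) 0 \<partial>M) + c * (\<integral>\<omega>. X \<omega> \<partial>M) \<le> c * t"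
proof -
  interpret prob_space M by fact
  have c: "0 < c" using \<alpha> by (simp add: c_def)
  let ?I = "\<lambda>x. \<integral>\<omega>. max (X \<omega> - x) 0 \<partial>M"
  define \<phi> where "\<phi> x = ?I x + c * ((\<integral>\<omega>. X \<omega> \<partial>M) - x)" for x
  have int[simp]: "integrable M (\<lambda>\<omega>. max (X \<omega> - x) 0)" for x
    using X by simp
  have I_anti: "?I y \<le> ?I x" if "x \<le> y" for x y
    using that by (intro integral_mono) auto
  have I_lip: "?I x \<le> ?I y + (y - x)" if "x \<le> y" for x y
  proof -
    have "?I x \<le> (\<integral>\<omega>. max (X \<omega> - y) 0 + (y - x) \<partial>M)"
      using that by (intro integral_mono) auto
    then show ?thesis by (simp add: prob_space)
  qed
  have strict: "\<phi> y < \<phi> x" if "x < y" for x y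
    using I_anti[of x y] mult_strict_left_mono[OF that c] that
    by (simp add: \<phi>_def right_diff_distrib)
  have "1-lipschitz_on UNIV ?I"
  proof (rule lipschitz_onI)
    fix x y :: real
    show "dist (?I x) (?I y) \<le> 1 * dist x y"
      using I_anti[of x y] I_lip[of x y] I_anti[of y x] I_lip[of y x]
      by (cases "x \<le> y") (simp_all add: dist_real_def)
  qed simp
  then have "continuous_on UNIV ?I" by (rule lipschitz_on_continuous_on)
  then have cont: "continuous_on S \<phi>" for S
    unfolding \<phi>_def by (intro continuous_intros) (auto elim: continuous_on_subset)
  (* B is large enough to make c * (B - E[X]) at least E|X|, which bounds E[(X - B)_+]. *)
  define B where "B = \<bar>\<integral>\<omega>. X \<omega> \<partial>M\<bar> + (\<integral>\<omega>. \<bar>X \<omega>\<bar> \<partial>M) / c"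
  have nonneg: "0 \<le> (\<integral>\<omega>. \<bar>X \<omega>\<bar> \<partial>M)" by simp
  have B: "0 \<le> B" "(\<integral>\<omega>. X \<omega> \<partial>M) \<le> B"
    using divide_nonneg_pos[OF nonneg c] abs_ge_self[of "\<integral>\<omega>. X \<omega> \<partial>M"]
    unfolding B_def by linarith+
  have "?I B \<le> (\<integral>\<omega>. \<bar>X \<omega>\<bar> \<partial>M)"
    using X B by (intro integral_mono) auto
  moreover have "c * ((\<integral>\<omega>. X \<omega> \<partial>M) - B) \<le> c * (- ((\<integral>\<omega>. \<bar>X \<omega>\<bar> \<partial>M) / c))"
    unfolding B_def using c by (intro mult_left_mono) auto
  ultimately have "\<phi> B \<le> 0"
    using c by (simp add: \<phi>_def)
  moreover have "0 \<le> \<phi> (\<integral>\<omega>. X \<omega> \<partial>M)" by (simp add: \<phi>_def)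
  ultimately obtain e where e: "\<phi> e = 0"
    using IVT2'[of \<phi> B 0 "\<integral>\<omega>. X \<omega> \<partial>M"] B cont by auto
  have "expectile \<alpha> M X = (THE x. \<phi> x = 0)"
    unfolding expectile_def \<phi>_def c_def
    using expectile_equation_iff[OF assms(1) X \<alpha>(1)] by simp
  also have "\<dots> = e"
    using e strict by (intro the_equality) (auto, metis less_irrefl linorder_neqE_linordered_idom)
  finally have root: "\<phi> (expectile \<alpha> M X) = 0" using e by simp
  then show "?I (expectile \<alpha> M X) + c * (\<integral>\<omega>. X \<omega> \<partial>M) = c * expectile \<alpha> M X"
    by (simp add: \<phi>_def right_diff_distrib)
  have "expectile \<alpha> M X \<le> t \<longleftrightarrow> \<phi> t \<le> 0"
    using root strict[of t "expectile \<alpha> M X"] strict[of "expectile \<alpha> M X" t] by (metis leD leI less_eq_real_def)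
  then show "expectile \<alpha> M X \<le> t \<longleftrightarrow> ?I t + c * (\<integral>\<omega>. X \<omega> \<partial>M) \<le> c * t"
    unfolding \<phi>_def right_diff_distrib by linarith
qed

section \<open>Multipliers from separating hyperplanes\<close>

text \<open>
  The achievable pairs of constraint value and objective value form a convex set (closed under
  worsening either coordinate), and the bound \<open>V\<close> says that it misses the quadrant \<open>x \<le> 0, y > V\<close>.
  A line separating the two has slope \<open>l\<close>; it cannot be vertical because the Slater point \<open>z0\<close>
  lies strictly to the left of the axis.
\<close>

lemma Lagrange_multiplier:
  fixes f g :: "'z::real_vector \<Rightarrow> real"
  assumes f: "concave_on C f" and g: "convex_on C g"
    and slater: "z0 \<in> C" "g z0 < 0"
    and V: "\<And>z. z \<in> C \<Longrightarrow> g z \<le> 0 \<Longrightarrow> f z \<le> V"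
  obtains l where "0 \<le> l" "\<And>z. z \<in> C \<Longrightarrow> f z - l * g z \<le> V"
proof -
  define A where "A = {(x, y). \<exists>z\<in>C. g z \<le> x \<and> y \<le> f z}"
  define B where "B = {(x::real, y). x \<le> 0 \<and> V < y}"
  have C: "convex C" using g by (simp add: convex_on_def)
  have "convex A"
    unfolding convex_alt
  proof clarify
    fix x y x' y' t :: real
    assume "(x, y) \<in> A" "(x', y') \<in> A" and t: "0 \<le> t" "t \<le> 1"
    then obtain z z' where z: "z \<in> C" "g z \<le> x" "y \<le> f z" and z': "z' \<in> C" "g z' \<le> x'" "y' \<le> f z'"
      by (auto simp: A_def)
    let ?w = "(1 - t) *\<^sub>R z + t *\<^sub>R z'"
    have "?w \<in> C" using C z z' t by (simp add: convex_alt)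
    moreover have "g ?w \<le> (1 - t) * g z + t * g z'"
      using convex_onD[OF g] t z z' by auto
    moreover have "(1 - t) * g z + t * g z' \<le> (1 - t) * x + t * x'"
      using z z' t by (intro add_mono mult_left_mono) auto
    moreover have "(1 - t) * f z + t * f z' \<le> f ?w"
      using convex_onD[OF f[unfolded concave_on_def]] t z z' by fastforce
    moreover have "(1 - t) * y + t * y' \<le> (1 - t) * f z + t * f z'"
      using z z' t by (intro add_mono mult_left_mono) auto
    ultimately show "(1 - t) *\<^sub>R (x, y) + t *\<^sub>R (x', y') \<in> A"
      by (auto simp: A_def intro!: bexI[of _ ?w])
  qed
  moreover have "convex B"
  proof -
    have "B = {..0} \<times> {V<..}" by (auto simp: B_def)
    then show ?thesis by (simp add: convex_Times)
  qed
  moreover have "A \<noteq> {}" using slater by (auto simp: A_def)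
  moreover have "B \<noteq> {}" by (auto simp: B_def intro!: exI[of _ 0] gt_ex)
  moreover have "A \<inter> B = {}" using V by (fastforce simp: A_def B_def)
  ultimately obtain w \<beta> where w: "w \<noteq> 0" "\<And>z. z \<in> A \<Longrightarrow> w \<bullet> z \<le> \<beta>" "\<And>z. z \<in> B \<Longrightarrow> w \<bullet> z \<ge> \<beta>"
    using separating_hyperplane_sets[of A B] by blast
  obtain p q where pq: "w = (p, q)" by (cases w)
  have wB: "\<beta> \<le> p * x + q * y" if "x \<le> 0" "V < y" for x y
    using w(3)[of "(x, y)"] that by (simp add: B_def pq)
  have wA: "p * g z + q * f z \<le> \<beta>" if "z \<in> C" for z
    using w(2)[of "(g z, f z)"] that by (auto simp: A_def pq)
  (* B is unbounded upwards and to the left, which fixes the signs of q and p. *)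
  have "0 \<le> q"
  proof (rule ccontr)
    assume q: "\<not> 0 \<le> q"
    define y where "y = max (V + 1) ((\<beta> - 1) / q)"
    have "q * y \<le> q * ((\<beta> - 1) / q)" unfolding y_def using q by (intro mult_left_mono_neg) auto
    moreover have "V < y" by (simp add: y_def)
    ultimately show False using wB[of 0 y] q by simp
  qed
  have "p \<le> 0"
  proof (rule ccontr)
    assume p: "\<not> p \<le> 0"
    define x where "x = min 0 ((\<beta> - 1 - q * (V + 1)) / p)"
    have "p * x \<le> p * ((\<beta> - 1 - q * (V + 1)) / p)" unfolding x_def using p by (intro mult_left_mono) auto
    then show False using wB[of x "V + 1"] p by (auto simp: x_def)
  qed
  have "0 < q"
  proof (rule ccontr)
    assume "\<not> 0 < q"
    then have "q = 0" using \<open>0 \<le> q\<close> by simp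
    (* The separating line is vertical, and the Slater point is on its wrong side. *)
    then have "p < 0" using w(1) \<open>p \<le> 0\<close> pq by (auto simp: zero_prod_def)
    then have "0 < p * g z0" using slater by (simp add: mult_neg_neg)
    then show False using wA[OF slater(1)] wB[of 0 "V + 1"] \<open>q = 0\<close> by simp
  qed
  have \<beta>: "\<beta> \<le> q * V"
  proof (rule field_le_epsilon)
    fix e :: real assume "0 < e"
    then show "\<beta> \<le> q * V + e"
      using wB[of 0 "V + e / q"] \<open>0 < q\<close> by (simp add: distrib_left)
  qed
  show ?thesis
  proof (rule that[of "- p / q"])
    show "0 \<le> - p / q" using \<open>p \<le> 0\<close> \<open>0 < q\<close> by (intro divide_nonneg_pos) auto
    fix z assume "z \<in> C"
    then have "p * g z + q * f z \<le> q * V" using wA \<beta> by fastforce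
    then show "f z - - p / q * g z \<le> V" using \<open>0 < q\<close> by (simp add: field_simps)
  qed
qed

text \<open>
  Separate the strict epigraph of \<open>\<phi>\<close> from the hypograph of the affine function over \<open>S\<close>. The
  hyperplane is not vertical because \<open>\<phi>\<close> is finite on the whole space, so it is the graph of
  the function in between.
\<close>

lemma convex_affine_sandwich:
  fixes \<phi> :: "'a::euclidean_space \<Rightarrow> real"
  assumes "convex S" "S \<noteq> {}" and \<phi>: "convex_on UNIV \<phi>"
    and le: "\<And>x. x \<in> S \<Longrightarrow> d \<bullet> x + k \<le> \<phi> x"
  obtains q \<beta> where "\<And>x. x \<in> S \<Longrightarrow> d \<bullet> x + k \<le> q \<bullet> x + \<beta>" "\<And>x. q \<bullet> x + \<beta> \<le> \<phi> x"
proof -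
  define A where "A = {(x, t). x \<in> S \<and> t \<le> d \<bullet> x + k}"
  define B where "B = {(x, t). \<phi> x < t}"
  have "convex A"
    unfolding convex_alt
  proof clarify
    fix x x' and s s' t :: real
    assume h: "(x, s) \<in> A" "(x', s') \<in> A" and t: "0 \<le> t" "t \<le> 1"
    have "(1 - t) * s + t * s' \<le> (1 - t) * (d \<bullet> x + k) + t * (d \<bullet> x' + k)"
      using h t by (intro add_mono mult_left_mono) (auto simp: A_def)
    also have "\<dots> = d \<bullet> ((1 - t) *\<^sub>R x + t *\<^sub>R x') + k"
      by (simp add: inner_add_right algebra_simps)
    finally show "(1 - t) *\<^sub>R (x, s) + t *\<^sub>R (x', s') \<in> A"
      using h t assms(1) by (auto simp: A_def convex_alt)
  qed
  moreover have "convex B"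
    unfolding convex_alt
  proof clarify
    fix x x' and s s' t :: real
    assume h: "(x, s) \<in> B" "(x', s') \<in> B" and t: "0 \<le> t" "t \<le> 1"
    have "\<phi> ((1 - t) *\<^sub>R x + t *\<^sub>R x') \<le> (1 - t) * \<phi> x + t * \<phi> x'"
      using convex_onD[OF \<phi>] t by auto
    also have "\<dots> < (1 - t) * s + t * s'"
    proof (cases "t = 0")
      case False
      then have "t * \<phi> x' < t * s'" using h t by (simp add: B_def)
      moreover have "(1 - t) * \<phi> x \<le> (1 - t) * s" using h t by (intro mult_left_mono) (auto simp: B_def)
      ultimately show ?thesis by linarith
    qed (use h in \<open>simp add: B_def\<close>)
    finally show "(1 - t) *\<^sub>R (x, s) + t *\<^sub>R (x', s') \<in> B" by (simp add: B_def)
  qed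
  moreover have "A \<noteq> {}" using assms(2) by (auto simp: A_def)
  moreover have "B \<noteq> {}" by (auto simp: B_def intro!: gt_ex)
  moreover have "A \<inter> B = {}" using le by (fastforce simp: A_def B_def)
  ultimately obtain w \<gamma> where w: "w \<noteq> 0" "\<And>z. z \<in> A \<Longrightarrow> w \<bullet> z \<le> \<gamma>" "\<And>z. z \<in> B \<Longrightarrow> w \<bullet> z \<ge> \<gamma>"
    using separating_hyperplane_sets[of A B] by blast
  obtain p \<tau> where p: "w = (p, \<tau>)" by (cases w)
  have wA: "p \<bullet> x + \<tau> * (d \<bullet> x + k) \<le> \<gamma>" if "x \<in> S" for x
    using w(2)[of "(x, d \<bullet> x + k)"] that by (simp add: A_def p)
  have wB: "\<gamma> \<le> p \<bullet> x + \<tau> * t" if "\<phi> x < t" for x t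
    using w(3)[of "(x, t)"] that by (simp add: B_def p)
  have "0 \<le> \<tau>"
  proof (rule ccontr)
    assume \<tau>: "\<not> 0 \<le> \<tau>"
    define y where "y = max (\<phi> 0 + 1) ((\<gamma> - 1) / \<tau>)"
    have "\<tau> * y \<le> \<tau> * ((\<gamma> - 1) / \<tau>)" unfolding y_def using \<tau> by (intro mult_left_mono_neg) auto
    moreover have "\<phi> 0 < y" by (simp add: y_def)
    ultimately show False using wB[of 0 y] \<tau> by simp
  qed
  moreover have "\<tau> \<noteq> 0"
  proof
    assume \<tau>: "\<tau> = 0"
    then have "p \<noteq> 0" using w(1) p by (auto simp: zero_prod_def)
    define x where "x = ((\<gamma> - 1) / (p \<bullet> p)) *\<^sub>R p"
    have "p \<bullet> x = \<gamma> - 1" using \<open>p \<noteq> 0\<close> by (simp add: x_def)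
    then show False using wB[of x "\<phi> x + 1"] \<tau> by simp
  qed
  ultimately have \<tau>: "0 < \<tau>" by simp
  show ?thesis
  proof (rule that[of "- (1 / \<tau>) *\<^sub>R p" "\<gamma> / \<tau>"])
    fix x assume "x \<in> S"
    then show "d \<bullet> x + k \<le> (- (1 / \<tau>) *\<^sub>R p) \<bullet> x + \<gamma> / \<tau>"
      using wA[of x] \<tau> by (simp add: field_simps)
  next
    fix x
    have "\<gamma> - p \<bullet> x \<le> \<tau> * \<phi> x"
    proof (rule field_le_epsilon)
      fix e :: real assume "0 < e"
      then show "\<gamma> - p \<bullet> x \<le> \<tau> * \<phi> x + e"
        using wB[of x "\<phi> x + e / \<tau>"] \<tau> by (simp add: distrib_left)
    qed
    then show "(- (1 / \<tau>) *\<^sub>R p) \<bullet> x + \<gamma> / \<tau> \<le> \<phi> x"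
      using \<tau> by (simp add: field_simps)
  qed
qed

section \<open>Transport plans and the maximization program\<close>

text \<open>
  The perspective of the convex function \<open>x \<mapsto> (nrm x - \<epsilon>)\<^sub>+ + c * nrm x\<close>: for \<open>p \<ge> 0\<close> and
  \<open>y = p *\<^sub>R x\<close> it is \<open>p\<close> times the value at \<open>x\<close>, the cost of moving mass \<open>p\<close> by \<open>x\<close>.
\<close>

definition excess_cost :: "('a \<Rightarrow> real) \<Rightarrow> real \<Rightarrow> real \<Rightarrow> 'a \<Rightarrow> real \<Rightarrow> real" where
  "excess_cost nrm c \<epsilon> y p = max (nrm y - \<epsilon> * p) 0 + c * nrm y"

text \<open>
  The maximization program without its inequality constraint: \<open>p $ i $ j\<close> is the share of the
  sample \<open>\<xi>h i\<close> that is moved to \<open>\<xi>\<close> for the sake of piece \<open>j\<close>, and \<open>y $ i $ j\<close> is share times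
  displacement. Existence of \<open>\<xi>\<close> expresses the constraint on the quotient of \<open>y $ i $ j\<close> by
  \<open>p $ i $ j\<close>, including its convention for a zero share, without a division.
\<close>

definition plans :: "'a::euclidean_space set \<Rightarrow> ('n::finite \<Rightarrow> 'a) \<Rightarrow> ((real^'k::finite^'n) \<times> ('a^'k^'n)) set" where
  "plans \<Xi> \<xi>h = {(p, y). (\<forall>i j. 0 \<le> p $ i $ j) \<and> (\<forall>i. (\<Sum>j\<in>UNIV. p $ i $ j) = 1) \<and>
     (\<forall>i j. \<exists>\<xi>\<in>\<Xi>. y $ i $ j = p $ i $ j *\<^sub>R (\<xi> - \<xi>h i))}"

definition plan_cost :: "('a::euclidean_space \<Rightarrow> real) \<Rightarrow> real \<Rightarrow> real \<Rightarrow> (real^'k::finite^'n::finite) \<times> ('a^'k^'n) \<Rightarrow> real" where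
  "plan_cost nrm c \<epsilon> = (\<lambda>(p, y).
     (1 / real CARD('n)) * (\<Sum>i\<in>UNIV. \<Sum>j\<in>UNIV. excess_cost nrm c \<epsilon> (y $ i $ j) (p $ i $ j)))"

lemma excess_cost_convex:
  assumes nrm: "is_norm nrm" and "0 \<le> c" "0 \<le> s" "0 \<le> t"
  shows "excess_cost nrm c \<epsilon> (s *\<^sub>R y + t *\<^sub>R y') (s * p + t * p')
     \<le> s * excess_cost nrm c \<epsilon> y p + t * excess_cost nrm c \<epsilon> y' p'"
proof -
  let ?h = "\<lambda>y p. max (nrm y - \<epsilon> * p) 0"
  have n: "nrm (s *\<^sub>R y + t *\<^sub>R y') \<le> s * nrm y + t * nrm y'"
    using is_norm_triangle[OF nrm, of "s *\<^sub>R y" "t *\<^sub>R y'"] assms by (simp add: is_norm_scale[OF nrm])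
  have "s * (nrm y - \<epsilon> * p) \<le> s * ?h y p" "t * (nrm y' - \<epsilon> * p') \<le> t * ?h y' p'"
    "0 \<le> s * ?h y p" "0 \<le> t * ?h y' p'"
    using assms by (auto intro!: mult_left_mono)
  then have "?h (s *\<^sub>R y + t *\<^sub>R y') (s * p + t * p') \<le> s * ?h y p + t * ?h y' p'"
    using n by (simp add: algebra_simps)
  moreover have "c * nrm (s *\<^sub>R y + t *\<^sub>R y') \<le> c * (s * nrm y + t * nrm y')"
    using n assms by (intro mult_left_mono)
  moreover have "c * (s * nrm y + t * nrm y') = s * (c * nrm y) + t * (c * nrm y')"
    by (simp add: algebra_simps)
  ultimately show ?thesis
    unfolding excess_cost_def distrib_left[of s] distrib_left[of t] by linarith
qed

lemma perspective_iff:
  fixes x0 :: "'a::real_vector"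
  assumes "x0 \<in> \<Xi>"
  shows "(p = 0 \<longrightarrow> y = 0) \<and> x0 + y /\<^sub>R p \<in> \<Xi> \<longleftrightarrow> (\<exists>\<xi>\<in>\<Xi>. y = p *\<^sub>R (\<xi> - x0))"
proof (cases "p = 0")
  case False
  show ?thesis
  proof
    assume "(p = 0 \<longrightarrow> y = 0) \<and> x0 + y /\<^sub>R p \<in> \<Xi>"
    then show "\<exists>\<xi>\<in>\<Xi>. y = p *\<^sub>R (\<xi> - x0)"
      using False by (intro bexI[of _ "x0 + y /\<^sub>R p"]) auto
  qed (use False in auto)
qed (use assms in auto)

lemma mem_max_feasible:
  fixes \<xi>h :: "'n::finite \<Rightarrow> 'a::euclidean_space"
    and z :: "(real^'k::finite^'n) \<times> ('a^'k^'n)"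
  assumes "\<And>i. \<xi>h i \<in> \<Xi>"
  shows "z \<in> max_feasible nrm \<alpha> \<epsilon> \<Xi> \<xi>h \<longleftrightarrow>
     z \<in> plans \<Xi> \<xi>h \<and> plan_cost nrm ((1 - \<alpha>) / (2 * \<alpha> - 1)) \<epsilon> z \<le> (1 - \<alpha>) / (2 * \<alpha> - 1) * \<epsilon>"
proof -
  obtain p y where z: "z = (p, y)" by (cases z)
  have cost: "plan_cost nrm c \<epsilon> (p, y)
      = (1 / real CARD('n)) * (\<Sum>i\<in>UNIV. \<Sum>j\<in>UNIV. max (nrm (y $ i $ j) - \<epsilon> * p $ i $ j) 0)
        + c * ((1 / real CARD('n)) * (\<Sum>i\<in>UNIV. \<Sum>j\<in>UNIV. nrm (y $ i $ j)))" for c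
    by (simp add: plan_cost_def excess_cost_def sum.distrib sum_distrib_left[symmetric] add_divide_distrib)
  show ?thesis
    unfolding z cost max_feasible_def plans_def mem_Collect_eq prod.case perspective_iff[OF assms]
    by blast
qed

text \<open>
  Shares times displacements add up to the total share times the displacement towards the
  weighted mean of the two targets, which lies in \<open>\<Xi>\<close> by convexity.
\<close>

lemma convex_plans:
  fixes \<xi>h :: "'n::finite \<Rightarrow> 'a::euclidean_space"
  assumes "convex \<Xi>"
  shows "convex (plans \<Xi> \<xi>h :: ((real^'k::finite^'n) \<times> ('a^'k^'n)) set)"
  unfolding convex_def
proof clarify
  fix p p' :: "real^'k^'n" and y y' :: "'a^'k^'n" and s t :: real
  assume z: "(p, y) \<in> plans \<Xi> \<xi>h" "(p', y') \<in> plans \<Xi> \<xi>h" and st: "0 \<le> s" "0 \<le> t" "s + t = 1"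
  have "\<exists>\<zeta>\<in>\<Xi>. s *\<^sub>R y $ i $ j + t *\<^sub>R y' $ i $ j = (s * p $ i $ j + t * p' $ i $ j) *\<^sub>R (\<zeta> - \<xi>h i)" for i j
  proof -
    obtain \<xi> \<xi>' where \<xi>: "\<xi> \<in> \<Xi>" "\<xi>' \<in> \<Xi>" "y $ i $ j = p $ i $ j *\<^sub>R (\<xi> - \<xi>h i)" "y' $ i $ j = p' $ i $ j *\<^sub>R (\<xi>' - \<xi>h i)"
      using z unfolding plans_def by blast
    define q q' where "q = s * p $ i $ j" and "q' = t * p' $ i $ j"
    have q: "0 \<le> q" "0 \<le> q'" using z st by (auto simp: plans_def q_def q'_def)
    have eq: "s *\<^sub>R y $ i $ j + t *\<^sub>R y' $ i $ j = q *\<^sub>R (\<xi> - \<xi>h i) + q' *\<^sub>R (\<xi>' - \<xi>h i)"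
      using \<xi> by (simp add: q_def q'_def)
    (* If no share is moved, any target will do. *)
    show ?thesis
    proof (cases "q + q' = 0")
      case True
      then have "q = 0" "q' = 0" using q by auto
      then show ?thesis using eq \<xi>(1) unfolding q_def q'_def by auto
    next
      case False
      let ?\<zeta> = "(q / (q + q')) *\<^sub>R \<xi> + (q' / (q + q')) *\<^sub>R \<xi>'"
      have "?\<zeta> \<in> \<Xi>"
        using \<xi> q False by (intro convexD[OF assms]) (auto simp: add_divide_distrib[symmetric])
      moreover have "(q + q') *\<^sub>R (?\<zeta> - \<xi>h i) = q *\<^sub>R (\<xi> - \<xi>h i) + q' *\<^sub>R (\<xi>' - \<xi>h i)"
      proof -
        have "(q + q') *\<^sub>R ?\<zeta> = q *\<^sub>R \<xi> + q' *\<^sub>R \<xi>'"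
          using False by (simp add: scaleR_add_right)
        then show ?thesis unfolding scaleR_diff_right by (simp add: algebra_simps)
      qed
      ultimately show ?thesis using eq unfolding q_def q'_def by metis
    qed
  qed
  then show "s *\<^sub>R (p, y) + t *\<^sub>R (p', y') \<in> plans \<Xi> \<xi>h"
    using z st by (auto simp: plans_def sum.distrib sum_distrib_left[symmetric])
qed

lemma convex_on_plan_cost:
  fixes nrm :: "'a::euclidean_space \<Rightarrow> real"
  assumes nrm: "is_norm nrm" and "0 \<le> c" "convex S"
  shows "convex_on S (plan_cost nrm c \<epsilon> :: (real^'k::finite^'n::finite) \<times> ('a^'k^'n) \<Rightarrow> real)"
proof (rule convex_onI[OF _ assms(3)])
  fix t :: real and z z' :: "(real^'k^'n) \<times> ('a^'k^'n)"
  assume t: "0 < t" "t < 1"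
  obtain p y p' y' where z: "z = (p, y)" "z' = (p', y')" by (cases z, cases z')
  let ?e = "excess_cost nrm c \<epsilon>"
  have "(\<Sum>i\<in>UNIV. \<Sum>j\<in>UNIV. ?e ((1 - t) *\<^sub>R y $ i $ j + t *\<^sub>R y' $ i $ j) ((1 - t) * p $ i $ j + t * p' $ i $ j))
     \<le> (\<Sum>i\<in>UNIV. \<Sum>j\<in>UNIV. (1 - t) * ?e (y $ i $ j) (p $ i $ j) + t * ?e (y' $ i $ j) (p' $ i $ j))"
    using t by (intro sum_mono excess_cost_convex[OF nrm assms(2)]) auto
  also have "\<dots> = (1 - t) * (\<Sum>i\<in>UNIV. \<Sum>j\<in>UNIV. ?e (y $ i $ j) (p $ i $ j))
      + t * (\<Sum>i\<in>UNIV. \<Sum>j\<in>UNIV. ?e (y' $ i $ j) (p' $ i $ j))"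
    by (simp add: sum.distrib sum_distrib_left)
  finally have "(1 / real CARD('n)) * (\<Sum>i\<in>UNIV. \<Sum>j\<in>UNIV. ?e ((1 - t) *\<^sub>R y $ i $ j + t *\<^sub>R y' $ i $ j) ((1 - t) * p $ i $ j + t * p' $ i $ j))
    \<le> (1 / real CARD('n)) * \<dots>"
    by (rule mult_left_mono) simp
  then show "plan_cost nrm c \<epsilon> ((1 - t) *\<^sub>R z + t *\<^sub>R z') \<le> (1 - t) * plan_cost nrm c \<epsilon> z + t * plan_cost nrm c \<epsilon> z'"
    unfolding z plan_cost_def by (simp add: distrib_left mult_ac)
qed

lemma max_objective_affine:
  fixes z z' :: "(real^'k::finite^'n::finite) \<times> ('a::euclidean_space^'k^'n)"
  shows "max_objective a b \<xi>h (s *\<^sub>R z + t *\<^sub>R z') = s * max_objective a b \<xi>h z + t * max_objective a b \<xi>h z'"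
proof -
  obtain p y p' y' where z: "z = (p, y)" "z' = (p', y')" by (cases z, cases z')
  define f where "f p y i j = a j \<bullet> (y $ i $ j) + (a j \<bullet> \<xi>h i + b j) * p $ i $ j"
    for p :: "real^'k^'n" and y :: "'a^'k^'n" and i j
  have "(\<Sum>i\<in>UNIV. \<Sum>j\<in>UNIV. f (s *\<^sub>R p + t *\<^sub>R p') (s *\<^sub>R y + t *\<^sub>R y') i j)
     = (\<Sum>i\<in>UNIV. \<Sum>j\<in>UNIV. s * f p y i j + t * f p' y' i j)"
    by (intro sum.cong refl) (simp add: f_def inner_add_right algebra_simps)
  also have "\<dots> = s * (\<Sum>i\<in>UNIV. \<Sum>j\<in>UNIV. f p y i j) + t * (\<Sum>i\<in>UNIV. \<Sum>j\<in>UNIV. f p' y' i j)"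
    by (simp only: sum.distrib sum_distrib_left)
  finally show ?thesis
    by (simp add: z max_objective_def f_def add_divide_distrib)
qed

lemma concave_on_max_objective:
  assumes "convex S"
  shows "concave_on S (max_objective a b \<xi>h)"
  unfolding concave_on_def
  by (rule convex_onI[OF _ assms]) (simp add: max_objective_affine)

lemma convex_max_feasible:
  fixes \<xi>h :: "'n::finite \<Rightarrow> 'a::euclidean_space"
  assumes "convex \<Xi>" "\<And>i. \<xi>h i \<in> \<Xi>" "is_norm nrm" "1/2 < \<alpha>" "\<alpha> < 1"
  shows "convex (max_feasible nrm \<alpha> \<epsilon> \<Xi> \<xi>h :: ((real^'k::finite^'n) \<times> ('a^'k^'n)) set)"
  unfolding convex_alt
proof clarify
  fix t :: real and p p' :: "real^'k^'n" and y y' :: "'a^'k^'n"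
  assume z: "(p, y) \<in> max_feasible nrm \<alpha> \<epsilon> \<Xi> \<xi>h" (is "?z \<in> _")
    and z': "(p', y') \<in> max_feasible nrm \<alpha> \<epsilon> \<Xi> \<xi>h" (is "?z' \<in> _") and t: "0 \<le> t" "t \<le> 1"
  define c where "c = (1 - \<alpha>) / (2 * \<alpha> - 1)"
  have c: "0 \<le> c" using assms by (simp add: c_def)
  note mem = mem_max_feasible[where \<xi>h = \<xi>h and \<alpha> = \<alpha>, OF assms(2), folded c_def]
  have plan: "(1 - t) *\<^sub>R ?z + t *\<^sub>R ?z' \<in> plans \<Xi> \<xi>h"
    using z z' t unfolding mem[where \<epsilon> = \<epsilon> and nrm = nrm]
    by (intro convexD[OF convex_plans[OF assms(1)]]) auto
  have "plan_cost nrm c \<epsilon> ((1 - t) *\<^sub>R ?z + t *\<^sub>R ?z') \<le> (1 - t) * plan_cost nrm c \<epsilon> ?z + t * plan_cost nrm c \<epsilon> ?z'"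
    by (rule convex_onD[OF convex_on_plan_cost[OF assms(3) c convex_UNIV]]) (use t in auto)
  also have "\<dots> \<le> (1 - t) * (c * \<epsilon>) + t * (c * \<epsilon>)"
    using z z' t unfolding mem by (intro add_mono mult_left_mono) auto
  finally have "plan_cost nrm c \<epsilon> ((1 - t) *\<^sub>R ?z + t *\<^sub>R ?z') \<le> c * \<epsilon>" by (simp add: algebra_simps)
  with plan show "(1 - t) *\<^sub>R ?z + t *\<^sub>R ?z' \<in> max_feasible nrm \<alpha> \<epsilon> \<Xi> \<xi>h"
    unfolding mem by blast
qed

section \<open>The minimization program\<close>

text \<open>
  Turns the only extended-real constraint into finite inequalities. It covers infinite values of
  the support function, which is \<open>-\<infinity>\<close> if \<open>\<Xi>\<close> is empty.
\<close>

lemma support_fun_le_iff: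
  "ereal \<beta> + support_fun \<Xi> w + ereal r \<le> ereal s \<longleftrightarrow> (\<forall>\<xi>\<in>\<Xi>. \<beta> + w \<bullet> \<xi> + r \<le> s)"
proof -
  have "ereal \<beta> + support_fun \<Xi> w + ereal r \<le> ereal s \<longleftrightarrow> support_fun \<Xi> w \<le> ereal (s - r - \<beta>)"
    by (cases "support_fun \<Xi> w") auto
  also have "\<dots> \<longleftrightarrow> (\<forall>\<xi>\<in>\<Xi>. w \<bullet> \<xi> \<le> s - r - \<beta>)"
    by (simp add: support_fun_def SUP_le_iff)
  finally show ?thesis by (auto simp: algebra_simps)
qed

lemma mem_min_feasible:
  "(l, s, u, v) \<in> min_feasible nrm \<alpha> \<epsilon> \<Xi> a b \<xi>h \<longleftrightarrow>
     (\<forall>i j. (\<forall>\<xi>\<in>\<Xi>. a j \<bullet> \<xi> + b j + u $ i $ j \<bullet> (\<xi> - \<xi>h i) + dual_norm nrm (v $ i $ j) * \<epsilon> \<le> s $ i) \<and>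
        dual_norm nrm (v $ i $ j) \<le> l \<and> dual_norm nrm (u $ i $ j + v $ i $ j) \<le> (1 - \<alpha>) / (2 * \<alpha> - 1) * l)"
  unfolding min_feasible_def mem_Collect_eq prod.case support_fun_le_iff
  by (simp add: inner_add_left inner_diff_right algebra_simps)

lemma convex_min_feasible:
  fixes nrm :: "'a::euclidean_space \<Rightarrow> real"
    and \<xi>h :: "'n::finite \<Rightarrow> 'a" and a :: "'k::finite \<Rightarrow> 'a"
  assumes nrm: "is_norm nrm" and "0 \<le> \<epsilon>"
  shows "convex (min_feasible nrm \<alpha> \<epsilon> \<Xi> a b \<xi>h)"
  unfolding convex_def
proof clarify
  fix l s u v l' s' u' v' and x t :: real
  assume z: "(l, s, u, v) \<in> min_feasible nrm \<alpha> \<epsilon> \<Xi> a b \<xi>h" "(l', s', u', v') \<in> min_feasible nrm \<alpha> \<epsilon> \<Xi> a b \<xi>h"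
    and t: "0 \<le> x" "0 \<le> t" "x + t = 1"
  define c where "c = (1 - \<alpha>) / (2 * \<alpha> - 1)"
  note h = z[unfolded mem_min_feasible, folded c_def, rule_format]
  have "(\<forall>\<xi>\<in>\<Xi>. a j \<bullet> \<xi> + b j + (x *\<^sub>R u $ i $ j + t *\<^sub>R u' $ i $ j) \<bullet> (\<xi> - \<xi>h i)
            + dual_norm nrm (x *\<^sub>R v $ i $ j + t *\<^sub>R v' $ i $ j) * \<epsilon> \<le> x * s $ i + t * s' $ i) \<and>
        dual_norm nrm (x *\<^sub>R v $ i $ j + t *\<^sub>R v' $ i $ j) \<le> x * l + t * l' \<and>
        dual_norm nrm ((x *\<^sub>R u $ i $ j + t *\<^sub>R u' $ i $ j) + (x *\<^sub>R v $ i $ j + t *\<^sub>R v' $ i $ j))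
           \<le> c * (x * l + t * l')" for i j
  proof (intro conjI ballI)
    show "dual_norm nrm (x *\<^sub>R v $ i $ j + t *\<^sub>R v' $ i $ j) \<le> x * l + t * l'"
      using h t by (intro dual_norm_convex_le[OF nrm]) auto
    have "dual_norm nrm (x *\<^sub>R (u $ i $ j + v $ i $ j) + t *\<^sub>R (u' $ i $ j + v' $ i $ j)) \<le> x * (c * l) + t * (c * l')"
      using h t by (intro dual_norm_convex_le[OF nrm]) auto
    then show "dual_norm nrm ((x *\<^sub>R u $ i $ j + t *\<^sub>R u' $ i $ j) + (x *\<^sub>R v $ i $ j + t *\<^sub>R v' $ i $ j))
           \<le> c * (x * l + t * l')"
      by (simp add: algebra_simps)
    fix \<xi> assume \<xi>: "\<xi> \<in> \<Xi>"
    let ?A = "\<lambda>u v. a j \<bullet> \<xi> + b j + u $ i $ j \<bullet> (\<xi> - \<xi>h i) + dual_norm nrm (v $ i $ j) * \<epsilon>"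
    have "dual_norm nrm (x *\<^sub>R v $ i $ j + t *\<^sub>R v' $ i $ j) \<le> x * dual_norm nrm (v $ i $ j) + t * dual_norm nrm (v' $ i $ j)"
      using t by (intro dual_norm_convex_le[OF nrm]) auto
    then have "dual_norm nrm (x *\<^sub>R v $ i $ j + t *\<^sub>R v' $ i $ j) * \<epsilon>
        \<le> (x * dual_norm nrm (v $ i $ j) + t * dual_norm nrm (v' $ i $ j)) * \<epsilon>"
      using assms(2) by (rule mult_right_mono)
    then have "a j \<bullet> \<xi> + b j + (x *\<^sub>R u $ i $ j + t *\<^sub>R u' $ i $ j) \<bullet> (\<xi> - \<xi>h i)
            + dual_norm nrm (x *\<^sub>R v $ i $ j + t *\<^sub>R v' $ i $ j) * \<epsilon>
        \<le> (x + t) * (a j \<bullet> \<xi> + b j) + (x *\<^sub>R u $ i $ j + t *\<^sub>R u' $ i $ j) \<bullet> (\<xi> - \<xi>h i)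
          + (x * dual_norm nrm (v $ i $ j) + t * dual_norm nrm (v' $ i $ j)) * \<epsilon>"
      using t by simp
    also have "\<dots> = x * ?A u v + t * ?A u' v'"
      by (simp add: inner_add_left algebra_simps)
    also have "\<dots> \<le> x * s $ i + t * s' $ i"
      using h \<xi> t by (intro add_mono mult_left_mono) auto
    finally show "a j \<bullet> \<xi> + b j + (x *\<^sub>R u $ i $ j + t *\<^sub>R u' $ i $ j) \<bullet> (\<xi> - \<xi>h i)
            + dual_norm nrm (x *\<^sub>R v $ i $ j + t *\<^sub>R v' $ i $ j) * \<epsilon> \<le> x * s $ i + t * s' $ i" .
  qed
  then show "x *\<^sub>R (l, s, u, v) + t *\<^sub>R (l', s', u', v') \<in> min_feasible nrm \<alpha> \<epsilon> \<Xi> a b \<xi>h"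
    by (simp add: mem_min_feasible c_def)
qed

lemma convex_on_min_objective:
  fixes S :: "(real \<times> (real^'n::finite) \<times> ('a::euclidean_space^'k::finite^'n) \<times> ('a^'k^'n)) set"
  assumes "convex S"
  shows "convex_on S (min_objective \<alpha> \<epsilon>)"
proof (rule convex_onI[OF _ assms])
  fix t :: real and z z' :: "real \<times> (real^'n) \<times> ('a^'k^'n) \<times> ('a^'k^'n)"
  obtain l r u v l' r' u' v' where z: "z = (l, r, u, v)" "z' = (l', r', u', v')"
    by (cases z, cases z')
  have "(\<Sum>i\<in>UNIV. (1 - t) * r $ i + t * r' $ i) = (1 - t) * (\<Sum>i\<in>UNIV. r $ i) + t * (\<Sum>i\<in>UNIV. r' $ i)"
    by (simp only: sum.distrib sum_distrib_left)
  then show "min_objective \<alpha> \<epsilon> ((1 - t) *\<^sub>R z + t *\<^sub>R z') \<le> (1 - t) * min_objective \<alpha> \<epsilon> z + t * min_objective \<alpha> \<epsilon> z'"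
    by (simp add: z min_objective_def distrib_left distrib_right mult_ac add_divide_distrib)
qed

section \<open>Strong duality\<close>

text \<open>
  Evaluating the bound at large multiples of \<open>x\<close> makes the constant \<open>\<beta>\<close> negligible.
\<close>

lemma dual_norm_le_of_minorant:
  fixes nrm :: "'a::euclidean_space \<Rightarrow> real"
  assumes nrm: "is_norm nrm" and "0 \<le> K" "\<And>x. q \<bullet> x + \<beta> \<le> K * nrm x"
  shows "dual_norm nrm q \<le> K"
proof (rule dual_norm_leI[OF nrm assms(2)])
  fix x
  show "q \<bullet> x \<le> K * nrm x"
  proof (rule field_le_epsilon)
    fix e :: real assume "0 < e"
    define r where "r = max 1 (- \<beta> / e)"
    have r: "0 < r" "- \<beta> \<le> r * e"
      using \<open>0 < e\<close> by (auto simp: r_def field_simps max_def)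
    have "r * (q \<bullet> x) \<le> K * (r * nrm x) + r * e"
      using assms(3)[of "r *\<^sub>R x"] r by (simp add: is_norm_scale[OF nrm])
    then have "r * (q \<bullet> x) \<le> r * (K * nrm x + e)" by (simp add: algebra_simps)
    then show "q \<bullet> x \<le> K * nrm x + e" using r by simp
  qed
qed

text \<open>
  Conjugate duality for the sum of \<open>l * (nrm x - \<epsilon>)\<^sub>+\<close> and \<open>l * c * nrm x\<close>: the slope \<open>q\<close> of an affine
  minorant splits into slopes \<open>v\<close> and \<open>q - v\<close> for the summands. As both are functions of \<open>nrm\<close>, a
  multiple of \<open>q\<close> itself can be taken for \<open>v\<close>: with \<open>D\<close> the dual norm of \<open>q\<close>, it carries the part
  of \<open>D\<close> in excess of \<open>c * l\<close>. The minorant at infinity gives \<open>D \<le> l + c * l\<close>, and on the ball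
  of radius \<open>\<epsilon>\<close>, where the first summand vanishes, it gives \<open>(D - c * l) * \<epsilon> \<le> - \<beta>\<close>.
\<close>

lemma excess_cost_minorant_split:
  fixes nrm :: "'a::euclidean_space \<Rightarrow> real"
  assumes nrm: "is_norm nrm" and "0 \<le> \<epsilon>" "0 \<le> c" "0 \<le> l"
    and le: "\<And>x. q \<bullet> x + \<beta> \<le> l * excess_cost nrm c \<epsilon> x 1"
  obtains v where "dual_norm nrm v \<le> l" "dual_norm nrm (q - v) \<le> c * l" "dual_norm nrm v * \<epsilon> \<le> - \<beta>"
proof -
  define D where "D = dual_norm nrm q"
  have D: "0 \<le> D" by (simp add: D_def dual_norm_nonneg[OF nrm])
  have "l * excess_cost nrm c \<epsilon> x 1 \<le> (l + c * l) * nrm x" for x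
  proof -
    have "l * max (nrm x - \<epsilon>) 0 \<le> l * nrm x"
      using assms is_norm_nonneg[OF nrm, of x] by (intro mult_left_mono) auto
    then show ?thesis by (simp add: excess_cost_def algebra_simps)
  qed
  then have Dl: "D \<le> l + c * l"
    unfolding D_def using le assms
    by (intro dual_norm_le_of_minorant[OF nrm, of _ _ \<beta>]) (auto intro: order_trans)
  have \<beta>: "\<beta> \<le> 0"
    using le[of 0] assms by (simp add: excess_cost_def is_norm_zero[OF nrm])
  (* On the ball of radius \<epsilon> the first summand vanishes. *)
  have "q \<bullet> (\<epsilon> *\<^sub>R x) \<le> c * l * \<epsilon> - \<beta>" if "nrm x \<le> 1" for x
  proof -
    have "nrm (\<epsilon> *\<^sub>R x) \<le> \<epsilon>"
      using that assms by (simp add: is_norm_scale[OF nrm] mult_left_le)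
    then have "l * excess_cost nrm c \<epsilon> (\<epsilon> *\<^sub>R x) 1 \<le> l * (c * \<epsilon>)"
      using assms unfolding excess_cost_def by (intro mult_left_mono) (auto intro: mult_left_mono)
    then show ?thesis using le[of "\<epsilon> *\<^sub>R x"] by (simp add: algebra_simps)
  qed
  then have "dual_norm nrm (\<epsilon> *\<^sub>R q) \<le> c * l * \<epsilon> - \<beta>"
    unfolding dual_norm_def using is_norm_zero[OF nrm]
    by (intro cSUP_least) (auto intro!: exI[of _ 0])
  moreover have "\<epsilon> * D \<le> dual_norm nrm (\<epsilon> *\<^sub>R q)"
  proof (cases "\<epsilon> = 0")
    case False
    then have "D \<le> (1 / \<epsilon>) * dual_norm nrm (\<epsilon> *\<^sub>R q)"
      unfolding D_def using dual_norm_scale_le[OF nrm, of "1 / \<epsilon>" "\<epsilon> *\<^sub>R q"] assms by simp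
    then show ?thesis using False assms by (simp add: field_simps)
  qed (simp add: dual_norm_nonneg[OF nrm])
  ultimately have D\<epsilon>: "(D - c * l) * \<epsilon> \<le> - \<beta>" by (simp add: algebra_simps)
  show ?thesis
  proof (cases "D \<le> c * l")
    case True
    show ?thesis
      by (rule that[of 0]) (use True assms \<beta> in \<open>auto simp: D_def dual_norm_zero[OF nrm]\<close>)
  next
    case False
    then have "0 < D" using assms D by (smt (verit) mult_nonneg_nonneg)
    define \<theta> where "\<theta> = (D - c * l) / D"
    have \<theta>: "0 \<le> \<theta>" "\<theta> * D = D - c * l" "0 \<le> 1 - \<theta>" "(1 - \<theta>) * D = c * l"
      using False \<open>0 < D\<close> assms by (auto simp: \<theta>_def field_simps)
    have v: "dual_norm nrm (\<theta> *\<^sub>R q) \<le> D - c * l"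
      using dual_norm_scale_le[OF nrm \<theta>(1), of q] \<theta> by (simp add: D_def)
    have "q - \<theta> *\<^sub>R q = (1 - \<theta>) *\<^sub>R q" by (simp add: algebra_simps)
    then have w: "dual_norm nrm (q - \<theta> *\<^sub>R q) \<le> c * l"
      using dual_norm_scale_le[OF nrm \<theta>(3), of q] \<theta> by (simp add: D_def)
    have "dual_norm nrm (\<theta> *\<^sub>R q) * \<epsilon> \<le> (D - c * l) * \<epsilon>"
      using v assms by (intro mult_right_mono)
    then show ?thesis using that[of "\<theta> *\<^sub>R q"] v w Dl D\<epsilon> by linarith
  qed
qed

text \<open>
  For a fixed sample \<open>x0\<close> and a fixed affine piece, a bound on the penalized piece over \<open>\<Xi>\<close> says
  that the piece lies below \<open>s\<close> plus the penalty. The affine function between the two, taken in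
  the displacement \<open>\<xi> - x0\<close>, has slope \<open>q = - u\<close>, and splitting \<open>q\<close> yields \<open>v\<close>.
\<close>

lemma Fenchel_multipliers:
  fixes nrm :: "'a::euclidean_space \<Rightarrow> real"
  assumes nrm: "is_norm nrm" and "0 \<le> \<epsilon>" "0 \<le> c" "0 \<le> l" and \<Xi>: "convex \<Xi>" "x0 \<in> \<Xi>"
    and le: "\<And>\<xi>. \<xi> \<in> \<Xi> \<Longrightarrow> d \<bullet> \<xi> + k - l * excess_cost nrm c \<epsilon> (\<xi> - x0) 1 \<le> s"
  obtains u v where "\<And>\<xi>. \<xi> \<in> \<Xi> \<Longrightarrow> d \<bullet> \<xi> + k + u \<bullet> (\<xi> - x0) + dual_norm nrm v * \<epsilon> \<le> s"
    "dual_norm nrm v \<le> l" "dual_norm nrm (u + v) \<le> c * l"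
proof -
  let ?\<phi> = "\<lambda>x. l * excess_cost nrm c \<epsilon> x 1"
  let ?S = "(\<lambda>\<xi>. \<xi> - x0) ` \<Xi>"
  have S: "convex ?S" "?S \<noteq> {}" using \<Xi> by (auto intro: convex_translation_subtract)
  have \<phi>: "convex_on UNIV ?\<phi>"
  proof (rule convex_onI)
    fix t :: real and x y :: 'a assume t: "0 < t" "t < 1"
    have "excess_cost nrm c \<epsilon> ((1 - t) *\<^sub>R x + t *\<^sub>R y) ((1 - t) * 1 + t * 1)
        \<le> (1 - t) * excess_cost nrm c \<epsilon> x 1 + t * excess_cost nrm c \<epsilon> y 1"
      using t by (intro excess_cost_convex[OF nrm assms(3)]) auto
    then have "?\<phi> ((1 - t) *\<^sub>R x + t *\<^sub>R y) \<le> l * ((1 - t) * excess_cost nrm c \<epsilon> x 1 + t * excess_cost nrm c \<epsilon> y 1)"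
      using assms(4) by (intro mult_left_mono) auto
    then show "?\<phi> ((1 - t) *\<^sub>R x + t *\<^sub>R y) \<le> (1 - t) * ?\<phi> x + t * ?\<phi> y"
      by (simp add: algebra_simps)
  qed simp
  have "d \<bullet> x + (d \<bullet> x0 + k - s) \<le> ?\<phi> x" if "x \<in> ?S" for x
    using that le by (fastforce simp: inner_diff_right)
  then obtain q \<beta> where q: "\<And>x. x \<in> ?S \<Longrightarrow> d \<bullet> x + (d \<bullet> x0 + k - s) \<le> q \<bullet> x + \<beta>" "\<And>x. q \<bullet> x + \<beta> \<le> ?\<phi> x"
    using convex_affine_sandwich[OF S \<phi>, of d "d \<bullet> x0 + k - s"] by blast
  obtain v where v: "dual_norm nrm v \<le> l" "dual_norm nrm (q - v) \<le> c * l" "dual_norm nrm v * \<epsilon> \<le> - \<beta>"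
    using excess_cost_minorant_split[OF assms(1-4) q(2)] by blast
  show ?thesis
  proof (rule that[of "- q" v])
    show "dual_norm nrm v \<le> l" by fact
    show "dual_norm nrm (- q + v) \<le> c * l"
      using v(2) dual_norm_minus[OF nrm, of "q - v"] by simp
    fix \<xi> assume "\<xi> \<in> \<Xi>"
    then show "d \<bullet> \<xi> + k + - q \<bullet> (\<xi> - x0) + dual_norm nrm v * \<epsilon> \<le> s"
      using q(1)[of "\<xi> - x0"] v(3) by (simp add: inner_diff_right)
  qed
qed

text \<open>
  A sum whose terms are chosen independently is maximized term by term, so \<open>s i\<close> can be the
  supremum of \<open>F i\<close>. Nearly optimal choices avoid the question of attainment.
\<close>

lemma separable_bound:
  fixes F :: "'i::finite \<Rightarrow> 'c \<Rightarrow> real"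
  assumes ne: "A \<noteq> {}" and le: "\<And>x. (\<And>i. x i \<in> A) \<Longrightarrow> (\<Sum>i\<in>UNIV. F i (x i)) \<le> B"
  obtains s where "\<And>i x. x \<in> A \<Longrightarrow> F i x \<le> s i" "(\<Sum>i\<in>UNIV. s i) \<le> B"
proof -
  obtain x0 where x0: "x0 \<in> A" using ne by blast
  have bdd: "bdd_above (F i ` A)" for i
  proof (rule bdd_aboveI2)
    fix x assume "x \<in> A"
    then have "(\<Sum>k\<in>UNIV. F k (((\<lambda>_. x0)(i := x)) k)) \<le> B"
      by (intro le) (simp add: x0)
    also have "(\<Sum>k\<in>UNIV. F k (((\<lambda>_. x0)(i := x)) k)) = F i x + (\<Sum>k\<in>UNIV - {i}. F k x0)"
      by (subst sum.remove[of _ i]) auto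
    finally show "F i x \<le> B - (\<Sum>k\<in>UNIV - {i}. F k x0)" by simp
  qed
  define s where "s i = (SUP x\<in>A. F i x)" for i
  show ?thesis
  proof (rule that)
    show "F i x \<le> s i" if "x \<in> A" for i x
      unfolding s_def using that bdd by (rule cSUP_upper)
    show "(\<Sum>i\<in>UNIV. s i) \<le> B"
    proof (rule field_le_epsilon)
      fix e :: real assume "0 < e"
      have "\<exists>x\<in>A. s i - e / real CARD('i) < F i x" for i
      proof -
        have "s i - e / real CARD('i) < (SUP x\<in>A. F i x)" using \<open>0 < e\<close> by (simp add: s_def)
        then show ?thesis using less_cSUP_iff[OF ne bdd] by blast
      qed
      then obtain x where x: "\<And>i. x i \<in> A" "\<And>i. s i - e / real CARD('i) < F i (x i)" by metis
      have "(\<Sum>i\<in>UNIV. s i - e / real CARD('i)) \<le> (\<Sum>i\<in>UNIV. F i (x i))"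
        by (intro sum_mono less_imp_le x)
      also have "\<dots> \<le> B" by (intro le x)
      finally show "(\<Sum>i\<in>UNIV. s i) \<le> B + e" by (simp add: sum_subtractf)
    qed
  qed
qed

text \<open>
  At the vertices of the simplices of shares, cost and objective are sums over the samples alone.
  With \<open>X = \<xi>h\<close> such a plan costs nothing, which makes it feasible, and a Slater point if \<open>\<epsilon> > 0\<close>.
\<close>

lemma vertex_plan:
  fixes X \<xi>h :: "'n::finite \<Rightarrow> 'a::euclidean_space" and J :: "'n \<Rightarrow> 'k::finite"
  assumes nrm: "is_norm nrm" and "\<And>i. X i \<in> \<Xi>"
  defines "z \<equiv> (\<chi> i j. if j = J i then 1 else 0, \<chi> i j. if j = J i then X i - \<xi>h i else 0)
     :: (real^'k^'n) \<times> ('a^'k^'n)"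
  shows vertex_plan_mem: "z \<in> plans \<Xi> \<xi>h"
    and vertex_plan_cost: "plan_cost nrm c \<epsilon> z
          = (1 / real CARD('n)) * (\<Sum>i\<in>UNIV. excess_cost nrm c \<epsilon> (X i - \<xi>h i) 1)"
    and vertex_plan_objective: "max_objective a b \<xi>h z
          = (1 / real CARD('n)) * (\<Sum>i\<in>UNIV. a (J i) \<bullet> X i + b (J i))"
proof -
  show "z \<in> plans \<Xi> \<xi>h"
    using assms by (auto simp: plans_def z_def)
  have "excess_cost nrm c \<epsilon> 0 0 = 0" by (simp add: excess_cost_def is_norm_zero[OF nrm])
  then have "(\<Sum>j\<in>UNIV. excess_cost nrm c \<epsilon> (if j = J i then X i - \<xi>h i else 0) (if j = J i then 1 else 0))
     = (\<Sum>j\<in>UNIV. if j = J i then excess_cost nrm c \<epsilon> (X i - \<xi>h i) 1 else 0)" for i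
    by (intro sum.cong) auto
  then show "plan_cost nrm c \<epsilon> z = (1 / real CARD('n)) * (\<Sum>i\<in>UNIV. excess_cost nrm c \<epsilon> (X i - \<xi>h i) 1)"
    by (simp add: plan_cost_def z_def)
  have "(\<Sum>j\<in>UNIV. a j \<bullet> (if j = J i then X i - \<xi>h i else 0) + (a j \<bullet> \<xi>h i + b j) * (if j = J i then 1 else 0))
     = (\<Sum>j\<in>UNIV. if j = J i then a (J i) \<bullet> X i + b (J i) else 0)" for i
    by (intro sum.cong) (auto simp: inner_diff_right)
  then show "max_objective a b \<xi>h z = (1 / real CARD('n)) * (\<Sum>i\<in>UNIV. a (J i) \<bullet> X i + b (J i))"
    by (simp add: max_objective_def z_def)
qed

text \<open>
  For \<open>\<epsilon> > 0\<close>, staying at the samples is a Slater point, so the inequality constraint has a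
  multiplier \<open>l\<close>, with which the penalized objective is bounded on all plans. On those that
  move each sample as a whole to one target for one piece, it separates over the samples. This
  gives \<open>s\<close>, and \<open>Fenchel_multipliers\<close> gives
  \<open>u\<close> and \<open>v\<close> for each sample and piece.

  For \<open>\<epsilon> = 0\<close> there is no Slater point. But then nothing can be moved, and \<open>u = - a j\<close>, \<open>v = 0\<close>
  attains the loss at the samples, as \<open>l\<close> can be taken large at no expense.
\<close>

lemma strong_duality:
  fixes nrm :: "'a::euclidean_space \<Rightarrow> real"
    and \<xi>h :: "'n::finite \<Rightarrow> 'a" and a :: "'k::finite \<Rightarrow> 'a"
  assumes nrm: "is_norm nrm" and \<epsilon>: "0 \<le> \<epsilon>" and \<alpha>: "1/2 < \<alpha>" "\<alpha> < 1"
    and \<Xi>: "convex \<Xi>" "\<And>i. \<xi>h i \<in> \<Xi>"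
    and V: "\<And>z. z \<in> max_feasible nrm \<alpha> \<epsilon> \<Xi> \<xi>h \<Longrightarrow> max_objective a b \<xi>h z \<le> V"
  obtains w where "w \<in> min_feasible nrm \<alpha> \<epsilon> \<Xi> a b \<xi>h" "min_objective \<alpha> \<epsilon> w \<le> V"
proof -
  define c where "c = (1 - \<alpha>) / (2 * \<alpha> - 1)"
  have c: "0 < c" using \<alpha> by (simp add: c_def)
  let ?N = "real CARD('n)"
  have V': "max_objective a b \<xi>h z \<le> V" if "z \<in> plans \<Xi> \<xi>h" "plan_cost nrm c \<epsilon> z \<le> c * \<epsilon>" for z
    using V that mem_max_feasible[where \<xi>h = \<xi>h, OF \<Xi>(2)] unfolding c_def by blast
  show ?thesis
  proof (cases "\<epsilon> = 0")
    case True
    define J where "J i = (SOME j. \<forall>j'. a j' \<bullet> \<xi>h i + b j' \<le> a j \<bullet> \<xi>h i + b j)" for i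
    have J: "a j \<bullet> \<xi>h i + b j \<le> a (J i) \<bullet> \<xi>h i + b (J i)" for i j
    proof -
      let ?f = "\<lambda>j. a j \<bullet> \<xi>h i + b j"
      have "Max (range ?f) \<in> range ?f" by (intro Max_in) auto
      then obtain j0 where j0: "Max (range ?f) = ?f j0" by (rule rangeE)
      have "\<forall>j'. ?f j' \<le> ?f j0" by (simp add: j0[symmetric])
      then show ?thesis unfolding J_def by (rule someI2) blast
    qed
    define S where "S = (\<Sum>i\<in>UNIV. a (J i) \<bullet> \<xi>h i + b (J i))"
    have "S / ?N \<le> V"
      using V'[OF vertex_plan_mem[OF nrm \<Xi>(2), where J = J]]
      unfolding vertex_plan_cost[OF nrm \<Xi>(2)] vertex_plan_objective[OF nrm \<Xi>(2)]
      by (simp add: True excess_cost_def is_norm_zero[OF nrm] S_def)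
    (* One multiplier has to dominate the constraints of all pieces. *)
    define L where "L = (\<Sum>j\<in>UNIV. dual_norm nrm (- a j)) / c"
    have L: "dual_norm nrm (- a j) \<le> c * L" for j
      using c member_le_sum[of j UNIV "\<lambda>j. dual_norm nrm (- a j)"]
      by (simp add: L_def dual_norm_nonneg[OF nrm])
    have "0 \<le> L" unfolding L_def using c by (simp add: sum_nonneg dual_norm_nonneg[OF nrm])
    show ?thesis
    proof (rule that[of "(L, \<chi> i. a (J i) \<bullet> \<xi>h i + b (J i), \<chi> i j. - a j, 0)"])
      show "(L, \<chi> i. a (J i) \<bullet> \<xi>h i + b (J i), \<chi> i j. - a j, 0) \<in> min_feasible nrm \<alpha> \<epsilon> \<Xi> a b \<xi>h"
        unfolding mem_min_feasible c_def[symmetric]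
        using L J \<open>0 \<le> L\<close> by (auto simp: dual_norm_zero[OF nrm] inner_diff_right True add.commute)
      show "min_objective \<alpha> \<epsilon> (L, \<chi> i. a (J i) \<bullet> \<xi>h i + b (J i), \<chi> i j. - a j, 0) \<le> V"
        using \<open>S / ?N \<le> V\<close> by (simp add: min_objective_def True S_def)
    qed
  next
    case False
    then have "0 < \<epsilon>" using \<epsilon> by simp
    let ?C = "plans \<Xi> \<xi>h :: ((real^'k^'n) \<times> ('a^'k^'n)) set"
    let ?f = "max_objective a b \<xi>h" and ?g = "\<lambda>z. plan_cost nrm c \<epsilon> z - c * \<epsilon>"
    have C: "convex ?C" by (rule convex_plans[OF \<Xi>(1)])
    have g: "convex_on ?C ?g"
      using convex_on_add[OF convex_on_plan_cost[OF nrm less_imp_le[OF c] C, of \<epsilon>] convex_on_const[of _ "- (c * \<epsilon>)", THEN iffD2, OF C]]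
      by simp
    define j0 :: 'k where "j0 = undefined"
    have z0: "(\<chi> i j. if j = j0 then 1 else 0, \<chi> i j. if j = j0 then \<xi>h i - \<xi>h i else 0) \<in> ?C" (is "?z0 \<in> _")
      by (rule vertex_plan_mem[OF nrm \<Xi>(2), where J = "\<lambda>_. j0"])
    have neg: "?g ?z0 < 0"
      unfolding vertex_plan_cost[OF nrm \<Xi>(2), where J = "\<lambda>_. j0"]
      using c \<open>0 < \<epsilon>\<close> by (simp add: excess_cost_def is_norm_zero[OF nrm])
    have "?f z \<le> V" if "z \<in> ?C" "?g z \<le> 0" for z
      using V'[OF that(1)] that(2) by simp
    from Lagrange_multiplier[OF concave_on_max_objective[OF C, of a b \<xi>h] g z0 neg this]
    obtain l where l: "0 \<le> l" "\<And>z. z \<in> ?C \<Longrightarrow> ?f z - l * ?g z \<le> V"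
      by blast
    define F where "F i = (\<lambda>(j, \<xi>). a j \<bullet> \<xi> + b j - l * excess_cost nrm c \<epsilon> (\<xi> - \<xi>h i) 1)" for i
    have "(\<Sum>i\<in>UNIV. F i (x i)) \<le> ?N * (V - l * c * \<epsilon>)" if x: "\<And>i. x i \<in> UNIV \<times> \<Xi>" for x
    proof -
      define J X where "J i = fst (x i)" and "X i = snd (x i)" for i
      have X: "X i \<in> \<Xi>" for i using x[of i] by (auto simp: X_def)
      have "(1 / ?N) * (\<Sum>i\<in>UNIV. a (J i) \<bullet> X i + b (J i))
          - l * ((1 / ?N) * (\<Sum>i\<in>UNIV. excess_cost nrm c \<epsilon> (X i - \<xi>h i) 1) - c * \<epsilon>) \<le> V"
        using l(2)[OF vertex_plan_mem[OF nrm X, where J = J]]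
        unfolding vertex_plan_cost[OF nrm X] vertex_plan_objective[OF nrm X] .
      then have "(1 / ?N) * (\<Sum>i\<in>UNIV. F i (x i)) \<le> V - l * c * \<epsilon>"
        by (simp add: F_def J_def X_def case_prod_beta sum_subtractf sum_distrib_left[symmetric] algebra_simps diff_divide_distrib)
      then show ?thesis by (simp add: field_simps)
    qed
    moreover have "(UNIV :: 'k set) \<times> \<Xi> \<noteq> {}" using \<Xi>(2) by auto
    ultimately obtain s where s: "\<And>i x. x \<in> UNIV \<times> \<Xi> \<Longrightarrow> F i x \<le> s i" "(\<Sum>i\<in>UNIV. s i) \<le> ?N * (V - l * c * \<epsilon>)"
      using separable_bound[of "UNIV \<times> \<Xi>" F "?N * (V - l * c * \<epsilon>)"] by auto
    define Q where "Q i j u v \<longleftrightarrow>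
        (\<forall>\<xi>\<in>\<Xi>. a j \<bullet> \<xi> + b j + u \<bullet> (\<xi> - \<xi>h i) + dual_norm nrm v * \<epsilon> \<le> s i) \<and>
        dual_norm nrm v \<le> l \<and> dual_norm nrm (u + v) \<le> c * l" for i j u v
    have "\<exists>u v. Q i j u v" for i j
    proof -
      have "a j \<bullet> \<xi> + b j - l * excess_cost nrm c \<epsilon> (\<xi> - \<xi>h i) 1 \<le> s i" if "\<xi> \<in> \<Xi>" for \<xi>
        using s(1)[of "(j, \<xi>)" i] that by (simp add: F_def)
      from Fenchel_multipliers[OF nrm \<epsilon> less_imp_le[OF c] l(1) \<Xi>(1) \<Xi>(2) this]
      obtain u v where "\<And>\<xi>. \<xi> \<in> \<Xi> \<Longrightarrow> a j \<bullet> \<xi> + b j + u \<bullet> (\<xi> - \<xi>h i) + dual_norm nrm v * \<epsilon> \<le> s i"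
        "dual_norm nrm v \<le> l" "dual_norm nrm (u + v) \<le> c * l"
        by blast
      then show ?thesis unfolding Q_def by blast
    qed
    then obtain u v where uv: "\<And>i j. Q i j (u i j) (v i j)"
      by metis
    show ?thesis
    proof (rule that[of "(l, \<chi> i. s i, \<chi> i j. u i j, \<chi> i j. v i j)"])
      show "(l, \<chi> i. s i, \<chi> i j. u i j, \<chi> i j. v i j) \<in> min_feasible nrm \<alpha> \<epsilon> \<Xi> a b \<xi>h"
        unfolding mem_min_feasible c_def[symmetric] using uv by (simp add: Q_def)
      show "min_objective \<alpha> \<epsilon> (l, \<chi> i. s i, \<chi> i j. u i j, \<chi> i j. v i j) \<le> V"
        unfolding min_objective_def prod.case c_def[symmetric] using s(2) by (simp add: field_simps)
    qed
  qed
qed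

section \<open>Weak duality\<close>

lemma empirical_integral:
  fixes \<xi>h :: "'n::finite \<Rightarrow> 'a::euclidean_space" and f :: "'a \<Rightarrow> real"
  assumes "f \<in> borel_measurable borel"
  shows "integrable (empirical \<xi>h) f"
    and "(\<integral>x. f x \<partial>empirical \<xi>h) = (1 / real CARD('n)) * (\<Sum>i\<in>UNIV. f (\<xi>h i))"
proof -
  have m: "\<xi>h \<in> measurable (uniform_count_measure UNIV) borel"
    by (simp add: measurable_def sets_uniform_count_measure space_uniform_count_measure)
  have "integrable (uniform_count_measure UNIV) (\<lambda>i. f (\<xi>h i))"
    unfolding uniform_count_measure_def by (rule integrable_point_measure_finite) simp
  then show "integrable (empirical \<xi>h) f"
    unfolding empirical_def using m assms by (simp add: integrable_distr_eq)
  show "(\<integral>x. f x \<partial>empirical \<xi>h) = (1 / real CARD('n)) * (\<Sum>i\<in>UNIV. f (\<xi>h i))"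
    unfolding empirical_def using m assms by (simp add: integral_distr integral_uniform_count_measure)
qed

lemma AE_empirical: "AE x in empirical \<xi>h. x \<in> range (\<xi>h :: 'n::finite \<Rightarrow> 'a::euclidean_space)"
proof -
  have "range \<xi>h \<in> sets borel" by (intro borel_closed finite_imp_closed) simp
  then show ?thesis
    unfolding empirical_def
    by (subst AE_distr_iff) (auto simp: measurable_def sets_uniform_count_measure space_uniform_count_measure)
qed

text \<open>
  A feasible point of the minimization program certifies a pointwise bound: write
  \<open>- u = v - (u + v)\<close> and apply the Hoelder inequality to both parts.
\<close>

lemma loss_le_min_feasible:
  fixes nrm :: "'a::euclidean_space \<Rightarrow> real"
    and \<xi>h :: "'n::finite \<Rightarrow> 'a" and a :: "'k::finite \<Rightarrow> 'a"
  assumes nrm: "is_norm nrm" and \<epsilon>: "0 \<le> \<epsilon>"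
    and feas: "(l, s, u, v) \<in> min_feasible nrm \<alpha> \<epsilon> \<Xi> a b \<xi>h" and "\<xi> \<in> \<Xi>"
  shows "(MAX j. a j \<bullet> \<xi> + b j) \<le> s $ i + l * excess_cost nrm ((1 - \<alpha>) / (2 * \<alpha> - 1)) \<epsilon> (\<xi> - \<xi>h i) 1"
proof -
  define c where "c = (1 - \<alpha>) / (2 * \<alpha> - 1)"
  define x where "x = \<xi> - \<xi>h i"
  have x: "0 \<le> nrm x" by (rule is_norm_nonneg[OF nrm])
  have "a j \<bullet> \<xi> + b j \<le> s $ i + l * excess_cost nrm c \<epsilon> x 1" for j
  proof -
    let ?v = "v $ i $ j" and ?u = "u $ i $ j"
    have h: "a j \<bullet> \<xi> + b j + ?u \<bullet> x + dual_norm nrm ?v * \<epsilon> \<le> s $ i"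
      "dual_norm nrm ?v \<le> l" "dual_norm nrm (?u + ?v) \<le> c * l"
      using feas \<open>\<xi> \<in> \<Xi>\<close> unfolding mem_min_feasible c_def x_def by blast+
    have "?v \<bullet> x - dual_norm nrm ?v * \<epsilon> \<le> dual_norm nrm ?v * (nrm x - \<epsilon>)"
      using dual_norm_Hoelder[OF nrm, of ?v x] by (simp add: right_diff_distrib)
    also have "\<dots> \<le> dual_norm nrm ?v * max (nrm x - \<epsilon>) 0"
      using dual_norm_nonneg[OF nrm] by (intro mult_left_mono) auto
    also have "\<dots> \<le> l * max (nrm x - \<epsilon>) 0"
      using h by (intro mult_right_mono) auto
    finally have 1: "?v \<bullet> x - dual_norm nrm ?v * \<epsilon> \<le> l * max (nrm x - \<epsilon>) 0" .
    have "- (?u + ?v) \<bullet> x \<le> dual_norm nrm (?u + ?v) * nrm x"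
      using dual_norm_Hoelder[OF nrm, of "- (?u + ?v)" x] by (simp only: dual_norm_minus[OF nrm])
    also have "\<dots> \<le> c * l * nrm x" using h x by (intro mult_right_mono)
    finally have 2: "- (?u + ?v) \<bullet> x \<le> c * l * nrm x" .
    have "l * excess_cost nrm c \<epsilon> x 1 = l * max (nrm x - \<epsilon>) 0 + c * l * nrm x"
      by (simp add: excess_cost_def algebra_simps)
    moreover have "- (?u + ?v) \<bullet> x = - (?u \<bullet> x) - ?v \<bullet> x"
      by (simp add: inner_diff_left)
    ultimately show ?thesis using h(1) 1 2 by linarith
  qed
  then show ?thesis unfolding c_def x_def by simp
qed

text \<open>
  Integrating the pointwise bound against a coupling turns its right-hand side into the
  integrals that \<open>expectile_le_iff\<close> controls. The slack \<open>\<delta>\<close> is there because the infimum in the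
  expectile distance need not be attained. Integrability of the loss has to be shown, as
  otherwise its integral would be \<open>0\<close> by convention; it follows from integrability of the
  transport distance, the samples being finitely many.
\<close>

lemma weak_duality_coupling:
  fixes nrm :: "'a::euclidean_space \<Rightarrow> real"
    and \<xi>h :: "'n::finite \<Rightarrow> 'a" and a :: "'k::finite \<Rightarrow> 'a"
  assumes nrm: "is_norm nrm" and \<epsilon>: "0 \<le> \<epsilon>" and \<alpha>: "1/2 < \<alpha>" "\<alpha> < 1"
    and feas: "w \<in> min_feasible nrm \<alpha> \<epsilon> \<Xi> a b \<xi>h"
    and \<gamma>: "\<gamma> \<in> couplings (empirical \<xi>h) P" and P: "P \<in> distributions_on \<Xi>"
    and int: "integrable \<gamma> (\<lambda>(\<xi>\<^sub>1, \<xi>\<^sub>2). nrm (\<xi>\<^sub>1 - \<xi>\<^sub>2))"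
    and le: "expectile \<alpha> \<gamma> (\<lambda>(\<xi>\<^sub>1, \<xi>\<^sub>2). nrm (\<xi>\<^sub>1 - \<xi>\<^sub>2)) \<le> \<epsilon> + \<delta>" and \<delta>: "0 \<le> \<delta>"
  shows "(\<integral>\<xi>. (MAX j. a j \<bullet> \<xi> + b j) \<partial>P) \<le> min_objective \<alpha> \<epsilon> w + fst w * (1 + (1 - \<alpha>) / (2 * \<alpha> - 1)) * \<delta>"
proof -
  obtain l s u v where w: "w = (l, s, u, v)" by (cases w)
  define c where "c = (1 - \<alpha>) / (2 * \<alpha> - 1)"
  define loss where "loss = (\<lambda>\<xi>. MAX j. a j \<bullet> \<xi> + b j)"
  define d where "d = (\<lambda>z. nrm (fst z - snd z))"
  have d_eq: "(\<lambda>(\<xi>\<^sub>1, \<xi>\<^sub>2). nrm (\<xi>\<^sub>1 - \<xi>\<^sub>2)) = d" by (auto simp: d_def)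
  have d0: "0 \<le> d z" for z by (simp add: d_def is_norm_nonneg[OF nrm])
  have d_int: "integrable \<gamma> d" using int by (simp add: d_eq)
  interpret prob_space \<gamma> using \<gamma> by (simp add: couplings_def)
  have sets: "sets \<gamma> = sets (borel \<Otimes>\<^sub>M borel)"
    and P1: "distr \<gamma> borel fst = empirical \<xi>h" and P2: "distr \<gamma> borel snd = P"
    using \<gamma> by (auto simp: couplings_def)
  have m[measurable]: "fst \<in> measurable \<gamma> borel" "snd \<in> measurable \<gamma> borel"
    by (simp_all add: measurable_cong_sets[OF sets refl] measurable_fst measurable_snd)
  have loss_m[measurable]: "loss \<in> borel_measurable borel" unfolding loss_def by measurable
  have "0 \<le> dual_norm nrm (v $ i $ j)" for i j by (rule dual_norm_nonneg[OF nrm])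
  then have l: "0 \<le> l"
    using feas unfolding w mem_min_feasible by (meson order_trans)
  have emp: "integrable \<gamma> (\<lambda>z. f (fst z))"
      "(\<integral>z. f (fst z) \<partial>\<gamma>) = (1 / real CARD('n)) * (\<Sum>i\<in>UNIV. f (\<xi>h i))"
    if [measurable]: "f \<in> borel_measurable borel" for f :: "'a \<Rightarrow> real"
    using empirical_integral[OF that, of \<xi>h] by (simp_all add: P1[symmetric] integrable_distr_eq integral_distr)
  have loss_int: "integrable \<gamma> (\<lambda>z. loss (snd z))"
  proof (rule Bochner_Integration.integrable_bound)
    let ?B = "\<lambda>z. \<Sum>j\<in>UNIV. dual_norm nrm (a j) * d z + \<bar>a j \<bullet> fst z + b j\<bar>"
    show "integrable \<gamma> ?B"
      using d_int by (intro Bochner_Integration.integrable_sum Bochner_Integration.integrable_add integrable_mult_right emp) auto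
    have "norm (loss (snd z)) \<le> norm (?B z)" for z
    proof -
      have "loss (snd z) \<in> range (\<lambda>j. a j \<bullet> snd z + b j)"
        unfolding loss_def by (rule Max_in) auto
      then obtain j where j: "loss (snd z) = a j \<bullet> snd z + b j" by auto
      have "\<bar>a j \<bullet> (snd z - fst z)\<bar> \<le> dual_norm nrm (a j) * d z"
        using dual_norm_Hoelder[OF nrm, of "a j" "snd z - fst z"] dual_norm_Hoelder[OF nrm, of "a j" "fst z - snd z"]
          is_norm_minus[OF nrm, of "fst z - snd z"]
        by (simp add: d_def inner_diff_right)
      then have "\<bar>loss (snd z)\<bar> \<le> dual_norm nrm (a j) * d z + \<bar>a j \<bullet> fst z + b j\<bar>"
        unfolding j by (simp add: inner_diff_right)
      also have "\<dots> \<le> ?B z"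
        by (rule member_le_sum) (auto simp: d0 dual_norm_nonneg[OF nrm])
      finally show ?thesis by simp
    qed
    then show "AE z in \<gamma>. norm (loss (snd z)) \<le> norm (?B z)" by simp
  qed measurable
  (* Several samples may sit at the same point, from which the index cannot be recovered.
     The smallest of their bounds is a function of the point alone. *)
  define h where "h x = (\<Sum>y\<in>range \<xi>h. indicator {y} x * Min ((\<lambda>i. s $ i) ` {i. \<xi>h i = y}))" for x
  have h_m[measurable]: "h \<in> borel_measurable borel" unfolding h_def by measurable
  have h: "h (\<xi>h i) = Min ((\<lambda>i. s $ i) ` {i'. \<xi>h i' = \<xi>h i})" for i
    unfolding h_def by (subst sum.remove[of _ "\<xi>h i"]) (auto intro!: sum.neutral)
  have "AE z in \<gamma>. fst z \<in> range \<xi>h"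
    by (rule AE_distrD[OF m(1)]) (simp only: P1 AE_empirical)
  moreover have "AE z in \<gamma>. snd z \<in> \<Xi>"
    by (rule AE_distrD[OF m(2)]) (use P in \<open>simp only: P2 distributions_on_def mem_Collect_eq\<close>)
  ultimately have bound: "AE z in \<gamma>. loss (snd z) \<le> h (fst z) + l * (max (d z - \<epsilon>) 0 + c * d z)"
  proof eventually_elim
    case (elim z)
    then obtain i where i: "fst z = \<xi>h i" by auto
    have "Min ((\<lambda>i. s $ i) ` {i'. \<xi>h i' = \<xi>h i}) \<in> (\<lambda>i. s $ i) ` {i'. \<xi>h i' = \<xi>h i}"
      by (rule Min_in) auto
    then obtain i' where i': "h (\<xi>h i) = s $ i'" "\<xi>h i' = \<xi>h i" unfolding h by auto
    have "excess_cost nrm c \<epsilon> (snd z - \<xi>h i') 1 = max (d z - \<epsilon>) 0 + c * d z"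
      using is_norm_minus[OF nrm, of "fst z - snd z"] i i' by (simp add: excess_cost_def d_def)
    then show ?case
      using loss_le_min_feasible[OF nrm \<epsilon> feas[unfolded w] elim(2), of i'] i i' by (simp add: loss_def c_def)
  qed
  have "max (d z - \<epsilon>) 0 \<le> max (d z - (\<epsilon> + \<delta>)) 0 + \<delta>" for z using \<delta> by simp
  then have "(\<integral>z. max (d z - \<epsilon>) 0 \<partial>\<gamma>) \<le> (\<integral>z. max (d z - (\<epsilon> + \<delta>)) 0 + \<delta> \<partial>\<gamma>)"
    using d_int by (intro integral_mono) auto
  also have "\<dots> = (\<integral>z. max (d z - (\<epsilon> + \<delta>)) 0 \<partial>\<gamma>) + \<delta>"
    using d_int by (simp add: prob_space)
  finally have cost: "(\<integral>z. max (d z - \<epsilon>) 0 \<partial>\<gamma>) + c * (\<integral>z. d z \<partial>\<gamma>) \<le> c * (\<epsilon> + \<delta>) + \<delta>"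
    using le[unfolded d_eq expectile_le_iff[OF prob_space_axioms d_int \<alpha>]] by (simp add: c_def)
  have "(\<integral>\<xi>. loss \<xi> \<partial>P) = (\<integral>z. loss (snd z) \<partial>\<gamma>)"
    unfolding P2[symmetric] by (simp add: integral_distr)
  also have "\<dots> \<le> (\<integral>z. h (fst z) + l * (max (d z - \<epsilon>) 0 + c * d z) \<partial>\<gamma>)"
    using loss_int bound d_int emp(1)[OF h_m] by (intro integral_mono_AE) auto
  also have "\<dots> = (1 / real CARD('n)) * (\<Sum>i\<in>UNIV. h (\<xi>h i)) + l * ((\<integral>z. max (d z - \<epsilon>) 0 \<partial>\<gamma>) + c * (\<integral>z. d z \<partial>\<gamma>))"
    using d_int emp[OF h_m] by simp
  also have "\<dots> \<le> (1 / real CARD('n)) * (\<Sum>i\<in>UNIV. s $ i) + l * (c * (\<epsilon> + \<delta>) + \<delta>)"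
    by (intro add_mono mult_left_mono sum_mono cost l) (auto simp: h intro!: Min_le)
  finally show ?thesis
    unfolding w min_objective_def prod.case loss_def c_def[symmetric] by (simp add: algebra_simps)
qed

lemma weak_duality:
  fixes nrm :: "'a::euclidean_space \<Rightarrow> real"
    and \<xi>h :: "'n::finite \<Rightarrow> 'a" and a :: "'k::finite \<Rightarrow> 'a"
  assumes nrm: "is_norm nrm" and \<epsilon>: "0 \<le> \<epsilon>" and \<alpha>: "1/2 < \<alpha>" "\<alpha> < 1"
    and feas: "w \<in> min_feasible nrm \<alpha> \<epsilon> \<Xi> a b \<xi>h"
    and P: "P \<in> expectile_ball nrm \<alpha> \<epsilon> \<Xi> (empirical \<xi>h)"
  shows "(\<integral>\<xi>. (MAX j. a j \<bullet> \<xi> + b j) \<partial>P) \<le> min_objective \<alpha> \<epsilon> w"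
proof (rule tendsto_lowerbound)
  let ?r = "\<lambda>\<delta>. min_objective \<alpha> \<epsilon> w + fst w * (1 + (1 - \<alpha>) / (2 * \<alpha> - 1)) * \<delta>"
  show "(?r \<longlongrightarrow> min_objective \<alpha> \<epsilon> w) (at_right 0)"
    by (auto intro!: tendsto_eq_intros)
  show "\<forall>\<^sub>F \<delta> in at_right 0. (\<integral>\<xi>. (MAX j. a j \<bullet> \<xi> + b j) \<partial>P) \<le> ?r \<delta>"
    unfolding eventually_at_filter
  proof (intro always_eventually allI impI)
    fix \<delta> :: real assume "\<delta> \<in> {0<..}"
    then have \<delta>: "0 < \<delta>" by simp
    have "expectile_dist nrm \<alpha> (empirical \<xi>h) P < ereal (\<epsilon> + \<delta>)"
      using P \<delta> by (auto simp: expectile_ball_def intro: le_less_trans)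
    then obtain \<gamma> where \<gamma>: "\<gamma> \<in> couplings (empirical \<xi>h) P"
      and lt: "(if integrable \<gamma> (\<lambda>(\<xi>\<^sub>1, \<xi>\<^sub>2). nrm (\<xi>\<^sub>1 - \<xi>\<^sub>2))
        then ereal (expectile \<alpha> \<gamma> (\<lambda>(\<xi>\<^sub>1, \<xi>\<^sub>2). nrm (\<xi>\<^sub>1 - \<xi>\<^sub>2))) else \<infinity>) < ereal (\<epsilon> + \<delta>)"
      unfolding expectile_dist_def INF_less_iff by blast
    then show "(\<integral>\<xi>. (MAX j. a j \<bullet> \<xi> + b j) \<partial>P) \<le> ?r \<delta>"
      using P \<delta> by (intro weak_duality_coupling[OF nrm \<epsilon> \<alpha> feas \<gamma>])
        (auto simp: expectile_ball_def split: if_splits)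
  qed
qed simp

section \<open>Plans as discrete distributions\<close>

text \<open>
  A feasible plan is a discrete coupling: mass \<open>p $ i $ j / N\<close> moves from \<open>\<xi>h i\<close> to a target \<open>T i j\<close>.
  Its cost is the left-hand side in \<open>expectile_le_iff\<close> at \<open>t = \<epsilon>\<close>, so the inequality constraint
  says exactly that the expectile of the transport distance is at most \<open>\<epsilon>\<close>. At each target the loss
  is at least the value of piece \<open>j\<close>, which is what the objective counts.
\<close>

lemma max_feasible_distribution:
  fixes nrm :: "'a::euclidean_space \<Rightarrow> real"
    and \<xi>h :: "'n::finite \<Rightarrow> 'a" and a :: "'k::finite \<Rightarrow> 'a"
  assumes nrm: "is_norm nrm" and \<epsilon>: "0 \<le> \<epsilon>" and \<alpha>: "1/2 < \<alpha>" "\<alpha> < 1"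
    and \<Xi>: "\<And>i. \<xi>h i \<in> \<Xi>" and feas: "z \<in> max_feasible nrm \<alpha> \<epsilon> \<Xi> \<xi>h"
  obtains P where "P \<in> expectile_ball nrm \<alpha> \<epsilon> \<Xi> (empirical \<xi>h)"
    "max_objective a b \<xi>h z \<le> (\<integral>\<xi>. (MAX j. a j \<bullet> \<xi> + b j) \<partial>P)"
proof -
  obtain p y where z: "z = (p, y)" by (cases z)
  define c where "c = (1 - \<alpha>) / (2 * \<alpha> - 1)"
  let ?N = "real CARD('n)"
  have plan: "z \<in> plans \<Xi> \<xi>h" and cost: "plan_cost nrm c \<epsilon> z \<le> c * \<epsilon>"
    using feas unfolding mem_max_feasible[where \<xi>h = \<xi>h, OF \<Xi>] c_def by auto
  have p0: "0 \<le> p $ i $ j" and p1: "(\<Sum>j\<in>UNIV. p $ i $ j) = 1" for i j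
    using plan by (auto simp: z plans_def)
  have "\<forall>i j. \<exists>\<xi>. \<xi> \<in> \<Xi> \<and> y $ i $ j = p $ i $ j *\<^sub>R (\<xi> - \<xi>h i)"
    using plan unfolding z plans_def by blast
  then obtain T where T: "\<And>i j. T i j \<in> \<Xi>" "\<And>i j. y $ i $ j = p $ i $ j *\<^sub>R (T i j - \<xi>h i)"
    by metis
  define f where "f = (\<lambda>(i, j). p $ i $ j / ?N)"
  define q where "q = embed_pmf f"
  have sum_f: "(\<Sum>x\<in>UNIV. g x * f x) = (1 / ?N) * (\<Sum>i\<in>UNIV. \<Sum>j\<in>UNIV. g (i, j) * p $ i $ j)" for g :: "'n \<times> 'k \<Rightarrow> real"
  proof -
    have "(\<Sum>x\<in>UNIV. g x * f x) = (\<Sum>i\<in>UNIV. \<Sum>j\<in>UNIV. g (i, j) * f (i, j))"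
      by (simp add: sum.cartesian_product case_prod_beta)
    then show ?thesis by (simp add: f_def sum_divide_distrib)
  qed
  have f0: "0 \<le> f x" for x by (auto simp: f_def p0 split: prod.split)
  have f1: "(\<integral>\<^sup>+x. ennreal (f x) \<partial>count_space UNIV) = 1"
    using sum_f[of "\<lambda>_. 1"] by (simp add: nn_integral_count_space_finite sum_ennreal f0 p1)
  have q: "(\<integral>x. g x \<partial>measure_pmf q) = (1 / ?N) * (\<Sum>i\<in>UNIV. \<Sum>j\<in>UNIV. g (i, j) * p $ i $ j)" for g :: "'n \<times> 'k \<Rightarrow> real"
    unfolding sum_f[symmetric] q_def
    by (subst integral_measure_pmf_real[of UNIV]) (auto simp: pmf_embed_pmf[OF f0 f1])
  have int_q: "integrable (measure_pmf q) g" for g :: "'n \<times> 'k \<Rightarrow> real"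
    by (rule integrable_measure_pmf_finite) simp
  define S where "S = (\<lambda>(i, j). (\<xi>h i, T i j))"
  define \<gamma> where "\<gamma> = distr (measure_pmf q) (borel \<Otimes>\<^sub>M borel) S"
  define P where "P = distr \<gamma> borel snd"
  have S[measurable]: "S \<in> measurable (measure_pmf q) (borel \<Otimes>\<^sub>M borel)"
    unfolding measurable_pmf_measure1 space_pair_measure by simp
  have P_eq: "P = distr (measure_pmf q) borel (\<lambda>x. snd (S x))"
    unfolding P_def \<gamma>_def distr_distr[OF measurable_snd S] by (simp add: o_def)
  have "distr \<gamma> borel fst = distr (measure_pmf q) borel (\<lambda>x. fst (S x))"
    unfolding \<gamma>_def distr_distr[OF measurable_fst S] by (simp add: o_def)
  also have "\<dots> = empirical \<xi>h"
  proof (rule measure_eqI)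
    fix B assume "B \<in> sets (distr (measure_pmf q) borel (\<lambda>x. fst (S x)))"
    then have B: "B \<in> sets borel" by simp
    interpret E: prob_space "empirical \<xi>h"
      unfolding empirical_def
      by (intro prob_space.prob_space_distr prob_space_uniform_count_measure)
        (auto simp: measurable_def sets_uniform_count_measure space_uniform_count_measure)
    interpret D: prob_space "distr (measure_pmf q) borel (\<lambda>x. fst (S x))"
      by (intro measure_pmf.prob_space_distr) simp
    have "measure (distr (measure_pmf q) borel (\<lambda>x. fst (S x))) B = (\<integral>x. indicator B (fst (S x)) \<partial>measure_pmf q)"
    proof -
      have "(\<lambda>x. indicator B (fst (S x)) :: real) = indicator ((\<lambda>x. fst (S x)) -` B)"
        by (auto simp: indicator_def)
      then show ?thesis using B by (simp add: measure_distr)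
    qed
    also have "\<dots> = (1 / ?N) * (\<Sum>i\<in>UNIV. indicator B (\<xi>h i))"
      by (simp add: q S_def sum_distrib_left[symmetric] p1)
    also have "\<dots> = measure (empirical \<xi>h) B" using B by (simp add: measure_empirical)
    finally show "emeasure (distr (measure_pmf q) borel (\<lambda>x. fst (S x))) B = emeasure (empirical \<xi>h) B"
      by (simp add: E.emeasure_eq_measure D.emeasure_eq_measure)
  qed (simp add: empirical_def)
  finally have P1: "distr \<gamma> borel fst = empirical \<xi>h" .
  interpret \<gamma>: prob_space \<gamma>
    unfolding \<gamma>_def by (intro measure_pmf.prob_space_distr S)
  have coupling: "\<gamma> \<in> couplings (empirical \<xi>h) P"
    unfolding couplings_def using P1 by (simp add: \<gamma>.prob_space_axioms P_def) (simp add: \<gamma>_def)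
  let ?d = "\<lambda>(\<xi>\<^sub>1, \<xi>\<^sub>2). nrm (\<xi>\<^sub>1 - \<xi>\<^sub>2)"
  have nrm_m[measurable]: "nrm \<in> borel_measurable borel"
    by (intro borel_measurable_continuous_onI continuous_on_is_norm[OF nrm])
  have d_m[measurable]: "?d \<in> borel_measurable (borel \<Otimes>\<^sub>M borel)" by measurable
  have d_int: "integrable \<gamma> ?d"
    unfolding \<gamma>_def by (subst integrable_distr_eq[OF S d_m]) (rule int_q)
  have "(\<integral>z. max (?d z - \<epsilon>) 0 \<partial>\<gamma>) + c * (\<integral>z. ?d z \<partial>\<gamma>) = (\<integral>x. max (?d (S x) - \<epsilon>) 0 + c * ?d (S x) \<partial>measure_pmf q)"
    unfolding \<gamma>_def by (subst (1 2) integral_distr[OF S]) (auto simp: int_q)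
  also have "\<dots> = plan_cost nrm c \<epsilon> z"
  proof -
    have "(max (nrm (\<xi>h i - T i j) - \<epsilon>) 0 + c * nrm (\<xi>h i - T i j)) * p $ i $ j = excess_cost nrm c \<epsilon> (y $ i $ j) (p $ i $ j)" for i j
    proof -
      have n: "nrm (y $ i $ j) = p $ i $ j * nrm (\<xi>h i - T i j)"
        using is_norm_minus[OF nrm, of "\<xi>h i - T i j"] by (simp add: T is_norm_scale[OF nrm] p0)
      have "max (nrm (\<xi>h i - T i j) - \<epsilon>) 0 * p $ i $ j = max (nrm (y $ i $ j) - \<epsilon> * p $ i $ j) 0"
        unfolding n max_mult_distrib_right using p0[of i j] by (simp add: algebra_simps)
      then show ?thesis by (simp add: excess_cost_def n algebra_simps)
    qed
    then show ?thesis by (simp add: q S_def z plan_cost_def)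
  qed
  finally have "expectile \<alpha> \<gamma> ?d \<le> \<epsilon>"
    using cost by (simp add: expectile_le_iff[OF \<gamma>.prob_space_axioms d_int \<alpha>] c_def)
  then have "expectile_dist nrm \<alpha> (empirical \<xi>h) P \<le> ereal \<epsilon>"
    unfolding expectile_dist_def using d_int by (intro INF_lower2[OF coupling]) auto
  moreover have "P \<in> distributions_on \<Xi>"
  proof -
    have "AE \<xi> in P. \<xi> \<in> range (\<lambda>x. snd (S x))"
      unfolding P_eq
      by (subst AE_distr_iff) (auto intro!: borel_closed finite_imp_closed)
    then have "AE \<xi> in P. \<xi> \<in> \<Xi>"
      by eventually_elim (auto simp: S_def T)
    moreover have "prob_space P" unfolding P_eq by (intro measure_pmf.prob_space_distr) simp
    moreover have "sets P = sets borel" by (simp add: P_def)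
    ultimately show ?thesis by (simp add: distributions_on_def)
  qed
  ultimately have ball: "P \<in> expectile_ball nrm \<alpha> \<epsilon> \<Xi> (empirical \<xi>h)"
    by (simp add: expectile_ball_def)
  let ?loss = "\<lambda>\<xi>. MAX j. a j \<bullet> \<xi> + b j"
  have "max_objective a b \<xi>h z = (1 / ?N) * (\<Sum>i\<in>UNIV. \<Sum>j\<in>UNIV. (a j \<bullet> T i j + b j) * p $ i $ j)"
    by (simp add: z max_objective_def T inner_diff_right algebra_simps)
  also have "\<dots> \<le> (1 / ?N) * (\<Sum>i\<in>UNIV. \<Sum>j\<in>UNIV. ?loss (T i j) * p $ i $ j)"
    using p0 by (intro mult_left_mono sum_mono mult_right_mono) auto
  also have "\<dots> = (\<integral>x. ?loss (snd (S x)) \<partial>measure_pmf q)"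
    by (simp add: q S_def)
  also have "\<dots> = (\<integral>\<xi>. ?loss \<xi> \<partial>P)"
    unfolding P_eq by (subst integral_distr) auto
  finally show ?thesis using that ball by blast
qed

section \<open>Equality of the three values\<close>

theorem theorem4:
  fixes \<Xi> :: "(real^'m) set"
    and \<xi>h :: "'n::finite \<Rightarrow> real^'m"
    and a :: "'k::finite \<Rightarrow> real^'m"
    and b :: "'k \<Rightarrow> real"
    and nrm :: "real^'m \<Rightarrow> real"
    and loss :: "real^'m \<Rightarrow> real"
    and \<epsilon> \<alpha> :: real
  assumes "convex \<Xi>"
    and "\<And>i. \<xi>h i \<in> \<Xi>"
    and "0 \<le> \<epsilon>"
    and "1/2 < \<alpha>" and "\<alpha> < 1"
    and "is_norm nrm"
    and "\<And>x. loss x = (MAX j. a j \<bullet> x + b j)"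
  shows "(SUP P\<in>expectile_ball nrm \<alpha> \<epsilon> \<Xi> (empirical \<xi>h). ereal (\<integral>\<xi>. loss \<xi> \<partial>P))
           = (SUP z\<in>max_feasible nrm \<alpha> \<epsilon> \<Xi> \<xi>h. ereal (max_objective a b \<xi>h z))
         \<and> concave_on (max_feasible nrm \<alpha> \<epsilon> \<Xi> \<xi>h) (max_objective a b \<xi>h)
         \<and> (SUP P\<in>expectile_ball nrm \<alpha> \<epsilon> \<Xi> (empirical \<xi>h). ereal (\<integral>\<xi>. loss \<xi> \<partial>P))
           = (INF z\<in>min_feasible nrm \<alpha> \<epsilon> \<Xi> a b \<xi>h. ereal (min_objective \<alpha> \<epsilon> z))
         \<and> convex_on (min_feasible nrm \<alpha> \<epsilon> \<Xi> a b \<xi>h) (min_objective \<alpha> \<epsilon>)"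
proof -
  note nrm = assms(6) and \<epsilon> = assms(3) and \<alpha> = assms(4,5)
  let ?W = "SUP P\<in>expectile_ball nrm \<alpha> \<epsilon> \<Xi> (empirical \<xi>h). ereal (\<integral>\<xi>. loss \<xi> \<partial>P)"
  let ?P = "SUP z\<in>max_feasible nrm \<alpha> \<epsilon> \<Xi> \<xi>h. ereal (max_objective a b \<xi>h z)"
  let ?D = "INF z\<in>min_feasible nrm \<alpha> \<epsilon> \<Xi> a b \<xi>h. ereal (min_objective \<alpha> \<epsilon> z)"
  have "?P \<le> ?W"
  proof (rule SUP_mono)
    fix z :: "(real^'k^'n) \<times> ((real^'m)^'k^'n)" assume "z \<in> max_feasible nrm \<alpha> \<epsilon> \<Xi> \<xi>h"
    from max_feasible_distribution[OF nrm \<epsilon> \<alpha> assms(2) this, of a b]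
    obtain P where "P \<in> expectile_ball nrm \<alpha> \<epsilon> \<Xi> (empirical \<xi>h)"
      "max_objective a b \<xi>h z \<le> (\<integral>\<xi>. loss \<xi> \<partial>P)"
      unfolding assms(7) by blast
    then show "\<exists>P\<in>expectile_ball nrm \<alpha> \<epsilon> \<Xi> (empirical \<xi>h). ereal (max_objective a b \<xi>h z) \<le> ereal (\<integral>\<xi>. loss \<xi> \<partial>P)"
      by (intro bexI[of _ P]) simp_all
  qed
  moreover have "?W \<le> ?D"
    unfolding assms(7) by (intro SUP_least INF_greatest ereal_less_eq(3)[THEN iffD2] weak_duality[OF nrm \<epsilon> \<alpha>])
  moreover have "?D \<le> ?P"
  proof (cases ?P)
    case (real V)
    have "max_objective a b \<xi>h z \<le> V" if "z \<in> max_feasible nrm \<alpha> \<epsilon> \<Xi> \<xi>h" for z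
      using SUP_upper[OF that, of "\<lambda>z. ereal (max_objective a b \<xi>h z)"] real by simp
    from strong_duality[where \<xi>h = \<xi>h, OF nrm \<epsilon> \<alpha> assms(1,2) this]
    obtain w where "w \<in> min_feasible nrm \<alpha> \<epsilon> \<Xi> a b \<xi>h" "min_objective \<alpha> \<epsilon> w \<le> V"
      by blast
    then show ?thesis unfolding real by (intro INF_lower2) auto
  next
    case MInf
    (* Staying at the samples is feasible; undefined serves as an arbitrary piece. *)
    let ?z = "(\<chi> i j. if j = undefined then 1 else 0, \<chi> i j. if j = undefined then \<xi>h i - \<xi>h i else 0)
      :: (real^'k^'n) \<times> ((real^'m)^'k^'n)"
    have "?z \<in> max_feasible nrm \<alpha> \<epsilon> \<Xi> \<xi>h"
      unfolding mem_max_feasible[where \<xi>h = \<xi>h, OF assms(2)]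
        vertex_plan_cost[OF nrm assms(2), where J = "\<lambda>_. undefined"]
      using vertex_plan_mem[OF nrm assms(2), where J = "\<lambda>_. undefined" and \<xi>h = \<xi>h] \<epsilon> \<alpha>
      by (simp add: excess_cost_def is_norm_zero[OF nrm])
    from SUP_upper[OF this, of "\<lambda>z. ereal (max_objective a b \<xi>h z)"] show ?thesis
      using MInf by simp
  qed simp
  ultimately have "?W = ?P" "?W = ?D" by (auto intro: antisym order_trans)
  moreover have "concave_on (max_feasible nrm \<alpha> \<epsilon> \<Xi> \<xi>h) (max_objective a b \<xi>h)"
    by (rule concave_on_max_objective[OF convex_max_feasible[where \<xi>h = \<xi>h, OF assms(1,2) nrm \<alpha>]])
  moreover have "convex_on (min_feasible nrm \<alpha> \<epsilon> \<Xi> a b \<xi>h) (min_objective \<alpha> \<epsilon>)"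
    by (rule convex_on_min_objective[OF convex_min_feasible[OF nrm \<epsilon>]])
  ultimately show ?thesis by blast
qed

end
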